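(* Let $p\in[0,1]$ and let $n,m$ be positive integers. If $p=0$ or $p=1$, then $|\min(\mathcal B_{n,m,p})|=1$ holds deterministically. Now let $0<p<1$ be a constant, let $m=m(n)$ be a positive-integer-valued function of $n$, and set $\alpha=-\frac{\log_{1-p} m}{n}$ (so $m=1/(1-p)^{\alpha n}$). All asymptotic statements below are as $n\to\infty$, with implied constants independent of $n$, $m$ and $\alpha$ (they may depend on $p$, and in (ii) on $\varepsilon,\varepsilon'$). (i) If $m\le 1/(1-p)^{(1-p)n}$, then $\mathbb E[\,|\min(\mathcal B_{n,m,p})|\,]=\Theta(m)$. (ii) For any two constants $\varepsilon,\varepsilon'>0$ and all $m$ with $1/(1-p)^{(1-p+\varepsilon)n}\le m\le 1/(1-p)^{(1-\varepsilon')n}$, i.e. $1-p+\varepsilon\le\alpha\le 1-\varepsilon'$, $$\mathbb E[\,|\min(\mathcal B_{n,m,p})|\,]=\Theta\!\left(2^{(\mathrm{H}(\alpha)+(1-\alpha)\log_2 p)\,n}\big/\sqrt n\right)=\Theta\!\left(\Big(\frac{p^{1-\alpha}}{(1-\alpha)^{1-\alpha}\alpha^{\alpha}}\Big)^{n}\Big/\sqrt n\right).$$ (iii) If $m=1/(1-p)^{n+f(n)}$ for some function $f=\omega(\log n)$, then $1\le \mathbb E[\,|\min(\mathcal B_{n,m,p})|\,]=1+o(1)$.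
   Context: For a probability $p$ and positive integers $n,m$, the random multi-hypergraph $\mathcal B_{n,m,p}$ on vertex set $[n]=\{1,\dots,n\}$ is obtained by independently sampling $m$ (not necessarily distinct) subsets of $[n]$, where each subset is generated by including each vertex $v\in[n]$ independently with probability $p$; the $m$ samples form the edges (a multiset). The minimization $\min(\mathcal H)$ of a multi-hypergraph $\mathcal H$ is the set of its inclusion-wise minimal edges, where a minimal edge occurring with multiplicity is counted only once (so $\min(\mathcal H)$ is a set). $\mathrm{H}(x)=-x\log_2 x-(1-x)\log_2(1-x)$ is the binary entropy function, with the convention $0\log_2 0=0$. *)

theory Defs
  imports "HOL-Probability.Probability"
begin

definition random_edge :: "nat \<Rightarrow> real \<Rightarrow> nat set pmf" where
  "random_edge n p =
     map_pmf (\<lambda>b. {v \<in> {1..n}. b v}) (Pi_pmf {1..n} False (\<lambda>_. bernoulli_pmf p))"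

definition random_hypergraph :: "nat \<Rightarrow> nat \<Rightarrow> real \<Rightarrow> nat set multiset pmf" where
  "random_hypergraph n m p = map_pmf mset (replicate_pmf m (random_edge n p))"

definition minimization :: "'a set multiset \<Rightarrow> 'a set set" where
  "minimization H = {e. e \<in># H \<and> (\<forall>e'. e' \<in># H \<longrightarrow> \<not> e' \<subset> e)}"

definition expected_min :: "nat \<Rightarrow> nat \<Rightarrow> real \<Rightarrow> real" where
  "expected_min n m p =
     measure_pmf.expectation (random_hypergraph n m p) (\<lambda>H. real (card (minimization H)))"

definition binary_entropy :: "real \<Rightarrow> real" where
  "binary_entropy x = - x * log 2 x - (1 - x) * log 2 (1 - x)"

end

theory Submission
  imports Defs "HOL-Real_Asymp.Real_Asymp"
begin

text \<open>
  Write $q = 1 - p$. A random edge is contained in a given set of size $k$ with probability $q^{n-k}$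
  and equal to it with probability $p^k q^{n-k}$, so this set is a minimal edge with probability
  $(1 - q^{n-k} + p^k q^{n-k})^m - (1 - q^{n-k})^m$, and summing over all sets gives the expectation
  exactly. The bracket is comparable to $m p^k q^{n-k}$ as long as $m q^{n-k} \<le> 1$, that is for
  $k \<le> x n$ with $x = 1 - \<alpha>$, and beyond that point it decays doubly exponentially in $k - x n$.
  For $x \<ge> p$ the sum therefore captures a constant fraction of the binomial distribution.
  For $x < p$ it is dominated by the terms with $k$ near $x n$: exponential tilting turns
  $m \binom{n}{k} p^k q^{n-k}$ into the binomial weight with parameter $x$, which is of order
  $1 / \sqrt n$ there by Stirling, times $(p^x x^{-x} (1-x)^{-(1-x)})^n$ and a factor that is
  geometric in $k - x n$. If $m q^n$ exceeds $n^2$, every nonempty set is minimal with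
  probability at most $e^{-q n^2}$, so only the empty edge survives.
\<close>

subsection \<open>Stirling bounds and the local limit of binomial weights\<close>

text \<open>The difference of the two sides vanishes at 1 and has derivative
  \<open>(t - 1)\<^sup>2 / (t * (t + 1)\<^sup>2)\<close>. At \<open>y = 1 + 1/n\<close> the bound
  becomes exactly \<open>1 / (n + 1/2)\<close>, which is the increment needed for Stirling's
  formula.\<close>

lemma ln_ge_pade:
  fixes y :: real
  assumes "1 \<le> y"
  shows "2 * (y - 1) / (y + 1) \<le> ln y"
proof -
  define g where "g = (\<lambda>t::real. ln t - 2 * (t - 1) / (t + 1))"
  have "\<exists>D. (g has_real_derivative D) (at t) \<and> 0 \<le> D" if "1 \<le> t" "t \<le> y" for t
  proof (intro exI conjI)
    show "(g has_real_derivative 1 / t - 4 / (t + 1)\<^sup>2) (at t)"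
      unfolding g_def using that
      by (auto intro!: derivative_eq_intros simp: power2_eq_square)
    have "1 / t - 4 / (t + 1)\<^sup>2 = (t - 1)\<^sup>2 / (t * (t + 1)\<^sup>2)"
      using that by (simp add: divide_simps power2_eq_square) (simp add: algebra_simps)
    then show "0 \<le> 1 / t - 4 / (t + 1)\<^sup>2"
      using that by simp
  qed
  then have "g 1 \<le> g y"
    using DERIV_nonneg_imp_nondecreasing[of 1 y g] assms by blast
  then show ?thesis
    by (simp add: g_def)
qed

text \<open>Again by the sign of a derivative, here
  \<open>(t - 1)\<^sup>2 / (2 * t\<^sup>2)\<close>. At \<open>y = 1 + 1/n\<close>, multiplication by
  \<open>n + 1/2\<close> gives \<open>1 + 1 / (4 * n * (n + 1))\<close>, whose excess over 1
  telescopes.\<close>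

lemma ln_le_half_diff_inverse:
  fixes y :: real
  assumes "1 \<le> y"
  shows "ln y \<le> (y - 1 / y) / 2"
proof -
  define g where "g = (\<lambda>t::real. (t - 1 / t) / 2 - ln t)"
  have "\<exists>D. (g has_real_derivative D) (at t) \<and> 0 \<le> D" if "1 \<le> t" "t \<le> y" for t
  proof (intro exI conjI)
    show "(g has_real_derivative (1 + 1 / t\<^sup>2) / 2 - 1 / t) (at t)"
      unfolding g_def using that
      by (auto intro!: derivative_eq_intros simp: power2_eq_square)
    have "(1 + 1 / t\<^sup>2) / 2 - 1 / t = (t - 1)\<^sup>2 / (2 * t\<^sup>2)"
      using that by (simp add: divide_simps power2_eq_square) (simp add: algebra_simps)
    then show "0 \<le> (1 + 1 / t\<^sup>2) / 2 - 1 / t"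
      by simp
  qed
  then have "g 1 \<le> g y"
    using DERIV_nonneg_imp_nondecreasing[of 1 y g] assms by blast
  then show ?thesis
    by (simp add: g_def)
qed

text \<open>The gap between \<open>ln (fact n)\<close> and \<open>(n + 1/2) * ln n - n\<close>
  equals 1 at \<open>n = 1\<close>. Each step lowers it by
  \<open>(n + 1/2) * (ln (n + 1) - ln n) - 1\<close>, which lies between 0 and
  \<open>1 / (4 * n) - 1 / (4 * (n + 1))\<close>. The term \<open>1 / (4 * n)\<close> in the lower
  bound makes the induction telescope.\<close>

lemma ln_fact_bounds:
  assumes "0 < n"
  shows "ln (fact n) \<le> (real n + 1/2) * ln (real n) - real n + 1"
    and "(real n + 1/2) * ln (real n) - real n + 3/4 + 1 / (4 * real n) \<le> ln (fact n)"
proof -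
  have step: "1 \<le> (real n + 1/2) * (ln (real n + 1) - ln (real n))"
    "(real n + 1/2) * (ln (real n + 1) - ln (real n)) \<le> 1 + (1 / (4 * real n) - 1 / (4 * (real n + 1)))"
    if n: "0 < n" for n
  proof -
    define y where "y = 1 + 1 / real n"
    have y: "1 \<le> y" "ln y = ln (real n + 1) - ln (real n)"
      using n ln_div[of "real n + 1" "real n"] by (auto simp: y_def add_divide_distrib)
    have "1 = (real n + 1/2) * (2 * (y - 1) / (y + 1))"
      using n by (simp add: y_def divide_simps)
    also have "\<dots> \<le> (real n + 1/2) * ln y"
      by (intro mult_left_mono ln_ge_pade y) auto
    finally show "1 \<le> (real n + 1/2) * (ln (real n + 1) - ln (real n))"
      by (simp add: y)
    have "(real n + 1/2) * ln y \<le> (real n + 1/2) * ((y - 1 / y) / 2)"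
      by (intro mult_left_mono ln_le_half_diff_inverse y) auto
    also have "\<dots> = 1 + (1 / (4 * real n) - 1 / (4 * (real n + 1)))"
      using n by (simp add: y_def divide_simps) (simp add: algebra_simps)
    finally show "(real n + 1/2) * (ln (real n + 1) - ln (real n))
        \<le> 1 + (1 / (4 * real n) - 1 / (4 * (real n + 1)))"
      by (simp add: y)
  qed
  have fact_step: "ln (fact (Suc n)) = ln (real n + 1) + ln (fact n)" for n
    by (simp add: ln_mult add.commute)
  from assms show "ln (fact n) \<le> (real n + 1/2) * ln (real n) - real n + 1"
  proof (induction n rule: nat_induct_non_zero)
    case (Suc n)
    then show ?case
      using step(1)[of n] fact_step[of n] by (simp add: algebra_simps)
  qed simp
  from assms show "(real n + 1/2) * ln (real n) - real n + 3/4 + 1 / (4 * real n) \<le> ln (fact n)"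
  proof (induction n rule: nat_induct_non_zero)
    case (Suc n)
    then show ?case
      using step(2)[of n] fact_step[of n] by (simp add: algebra_simps)
  qed simp
qed

text \<open>Only the order of magnitude matters later, so the constants 1 and e replace the sharp
  constant sqrt(2 pi) between them.\<close>

lemma fact_stirling_bounds:
  assumes "0 < n"
  shows "fact n \<le> exp 1 * (sqrt (real n) * (real n / exp 1) ^ n)"
    and "sqrt (real n) * (real n / exp 1) ^ n \<le> fact n"
proof -
  have *: "sqrt (real n) * (real n / exp 1) ^ n = exp ((real n + 1/2) * ln (real n) - real n)"
  proof -
    have "sqrt (real n) = exp (1/2 * ln (real n))"
      using assms by (simp add: powr_half_sqrt[symmetric] powr_def)
    moreover have "(real n / exp 1) ^ n = exp (real n * (ln (real n) - 1))"
      using assms by (simp add: exp_of_nat_mult exp_diff)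
    ultimately show ?thesis
      by (simp add: exp_add[symmetric] algebra_simps)
  qed
  have "fact n = exp (ln (fact n :: real))"
    by simp
  also have "\<dots> \<le> exp ((real n + 1/2) * ln (real n) - real n + 1)"
    using ln_fact_bounds(1)[OF assms] by (simp only: exp_le_cancel_iff)
  also have "\<dots> = exp 1 * (sqrt (real n) * (real n / exp 1) ^ n)"
    unfolding * by (simp add: exp_add[symmetric])
  finally show "fact n \<le> exp 1 * (sqrt (real n) * (real n / exp 1) ^ n)" .
  have "exp ((real n + 1/2) * ln (real n) - real n) \<le> exp (ln (fact n :: real))"
  proof -
    have "0 \<le> 1 / (4 * real n)" by simp
    then show ?thesis
      using ln_fact_bounds(2)[OF assms] by (simp only: exp_le_cancel_iff)
  qed
  then show "sqrt (real n) * (real n / exp 1) ^ n \<le> fact n"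
    unfolding * by simp
qed

lemma power_le_exp_minus_one:
  fixes y :: real
  assumes "0 \<le> y"
  shows "y ^ j \<le> exp (real j * (y - 1))"
proof -
  have "y ^ j \<le> exp (y - 1) ^ j"
    using exp_ge_add_one_self[of "y - 1"] assms by (intro power_mono) auto
  then show ?thesis
    by (simp add: exp_of_nat_mult)
qed

text \<open>This is $\exp(-n D(k/n \| x))$ for the binary relative entropy $D$.\<close>

definition divergence_factor :: "nat \<Rightarrow> nat \<Rightarrow> real \<Rightarrow> real" where
  "divergence_factor n k x = (real n * x / real k) ^ k * (real n * (1 - x) / real (n - k)) ^ (n - k)"

context
  fixes n k :: nat and x :: real
  assumes k: "0 < k" "k < n" and x: "0 < x" "x < 1"
begin

lemma divergence_factor_pos: "0 < divergence_factor n k x"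
  using k x by (simp add: divergence_factor_def)

text \<open>Nonnegativity of relative entropy: bounding both powers by exponentials leaves the
  exponents \<open>n * x - k\<close> and \<open>n * (1 - x) - (n - k)\<close>, which cancel.\<close>

lemma divergence_factor_le_1: "divergence_factor n k x \<le> 1"
proof -
  have "divergence_factor n k x \<le> exp (real k * (real n * x / real k - 1))
      * exp (real (n - k) * (real n * (1 - x) / real (n - k) - 1))"
    unfolding divergence_factor_def using k x by (intro mult_mono power_le_exp_minus_one) auto
  also have "\<dots> = exp 0"
    unfolding exp_add[symmetric] using k by (simp add: field_simps of_nat_diff)
  finally show ?thesis by simp
qed

text \<open>Relative entropy is at most the chi-square divergence: the same exponential bound,
  applied to the reciprocal, leaves exponents that add up to the chi-square expression.\<close>

lemma divergence_factor_ge: "exp (- ((real k - real n * x)\<^sup>2 / (real n * x * (1 - x)))) \<le> divergence_factor n k x"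
proof -
  have "1 / divergence_factor n k x = (real k / (real n * x)) ^ k * (real (n - k) / (real n * (1 - x))) ^ (n - k)"
    by (simp add: divergence_factor_def power_divide)
  also have "\<dots> \<le> exp (real k * (real k / (real n * x) - 1))
      * exp (real (n - k) * (real (n - k) / (real n * (1 - x)) - 1))"
    using k x by (intro mult_mono power_le_exp_minus_one) auto
  also have "\<dots> = exp ((real k - real n * x)\<^sup>2 / (real n * x * (1 - x)))"
  proof -
    have "real n \<noteq> 0" "x \<noteq> 0" "1 - x \<noteq> 0" using k x by auto
    then have "real k * (real k / (real n * x) - 1)
        + (real n - real k) * ((real n - real k) / (real n * (1 - x)) - 1)
        = (real k - real n * x)\<^sup>2 / (real n * x * (1 - x))"
      by (simp add: divide_simps power2_eq_square) (simp add: algebra_simps)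
    then show ?thesis
      unfolding exp_add[symmetric] using k by (simp add: of_nat_diff)
  qed
  finally show ?thesis
    using divergence_factor_pos by (simp add: exp_minus field_simps)
qed

text \<open>Dividing the Stirling main term of \<open>fact n\<close> by those of
  \<open>fact k\<close> and \<open>fact (n - k)\<close> cancels all powers of e. What remains of the
  binomial weight is a square root prefactor times the divergence factor.\<close>

lemma stirling_quotient:
  "sqrt (real n) * (real n / exp 1) ^ n * x ^ k * (1 - x) ^ (n - k)
    = sqrt (real n) / (sqrt (real k) * sqrt (real (n - k))) * divergence_factor n k x
      * (sqrt (real k) * (real k / exp 1) ^ k) * (sqrt (real (n - k)) * (real (n - k) / exp 1) ^ (n - k))"
proof -
  have "real n ^ n = real n ^ k * real n ^ (n - k)" "exp 1 ^ n = (exp 1 ^ k * exp 1 ^ (n - k) :: real)"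
    using k by (simp_all add: power_add[symmetric])
  then show ?thesis
    using k by (simp add: divergence_factor_def power_divide power_mult_distrib)
qed

lemma Bernstein_eq_fact:
  "Bernstein n k x * fact k * fact (n - k) = fact n * x ^ k * (1 - x) ^ (n - k)"
  using k by (simp add: Bernstein_def binomial_fact)

lemma Bernstein_le_stirling:
  "Bernstein n k x \<le> exp 1 * (sqrt (real n) / (sqrt (real k) * sqrt (real (n - k))))"
proof -
  let ?s = "sqrt (real n) / (sqrt (real k) * sqrt (real (n - k)))"
  let ?F = "\<lambda>j. sqrt (real j) * (real j / exp 1) ^ j"
  have F: "0 < ?F k" "0 < ?F (n - k)"
    using k by auto
  have "Bernstein n k x * (?F k * ?F (n - k)) \<le> Bernstein n k x * (fact k * fact (n - k))"
    using k x by (intro mult_left_mono mult_mono fact_stirling_bounds Bernstein_nonneg) auto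
  also have "\<dots> = fact n * (x ^ k * (1 - x) ^ (n - k))"
    using Bernstein_eq_fact by (simp add: mult_ac)
  also have "\<dots> \<le> exp 1 * ?F n * (x ^ k * (1 - x) ^ (n - k))"
    using fact_stirling_bounds(1)[of n] k x by (intro mult_right_mono) auto
  also have "\<dots> = exp 1 * (?F n * x ^ k * (1 - x) ^ (n - k))"
    by simp
  also have "\<dots> = (exp 1 * ?s) * divergence_factor n k x * (?F k * ?F (n - k))"
    unfolding stirling_quotient by simp
  also have "\<dots> \<le> (exp 1 * ?s) * 1 * (?F k * ?F (n - k))"
    by (intro mult_right_mono mult_left_mono divergence_factor_le_1) auto
  finally show ?thesis
    using F by (simp only: mult_1_right) (simp only: mult_le_cancel_right mult_pos_pos order_less_not_sym simp_thms)
qed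

text \<open>The factor \<open>exp (- 2)\<close> pays for the upper Stirling bounds on
  \<open>fact k\<close> and \<open>fact (n - k)\<close>, each of which loses a factor e.\<close>

lemma Bernstein_ge_stirling:
  "exp (- 2) * (sqrt (real n) / (sqrt (real k) * sqrt (real (n - k))))
    * exp (- ((real k - real n * x)\<^sup>2 / (real n * x * (1 - x)))) \<le> Bernstein n k x"
proof -
  let ?s = "sqrt (real n) / (sqrt (real k) * sqrt (real (n - k)))"
  let ?F = "\<lambda>j. sqrt (real j) * (real j / exp 1) ^ j"
  let ?E = "exp (- ((real k - real n * x)\<^sup>2 / (real n * x * (1 - x))))"
  have F: "0 < ?F k * ?F (n - k)"
    using k by auto
  have "(?s * ?E) * (?F k * ?F (n - k)) \<le> (?s * divergence_factor n k x) * (?F k * ?F (n - k))"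
    using k by (intro mult_right_mono mult_left_mono divergence_factor_ge) auto
  also have "\<dots> = ?F n * (x ^ k * (1 - x) ^ (n - k))"
    using stirling_quotient by (simp add: mult_ac)
  also have "\<dots> \<le> fact n * (x ^ k * (1 - x) ^ (n - k))"
    using fact_stirling_bounds(2)[of n] k x by (intro mult_right_mono) auto
  also have "\<dots> = Bernstein n k x * (fact k * fact (n - k))"
    using Bernstein_eq_fact by (simp add: mult_ac)
  also have "\<dots> \<le> Bernstein n k x * ((exp 1 * ?F k) * (exp 1 * ?F (n - k)))"
    using k x by (intro mult_left_mono mult_mono fact_stirling_bounds Bernstein_nonneg) auto
  also have "\<dots> = (exp 2 * Bernstein n k x) * (?F k * ?F (n - k))"
    using exp_add[of 1 "1::real"] by simp
  finally have "?s * ?E \<le> exp 2 * Bernstein n k x"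
    using F by (simp only: mult_le_cancel_right order_less_not_sym simp_thms)
  then have "exp (- 2) * (?s * ?E) \<le> exp (- 2) * (exp 2 * Bernstein n k x)"
    by (intro mult_left_mono) auto
  then show ?thesis
    by (simp add: mult.assoc[symmetric] exp_add[symmetric])
qed

end

section \<open>Uniform bounds of order \<open>1 / sqrt n\<close> for binomial weights\<close>

lemma sum_Bernstein_variance:
  "(\<Sum>k\<le>n. (real k - real n * x)\<^sup>2 * Bernstein n k x) = real n * x * (1 - x)"
proof -
  \<comment> \<open>Expansion into the factorial moments \<open>k * (k - 1)\<close> and
    \<open>k\<close>, whose sums against \<open>Bernstein n k x\<close> are known in closed
    form.\<close>
  have *: "\<And>a b x::real. (a - b)\<^sup>2 * x = a * (a - 1) * x + (1 - 2 * b) * a * x + b * b * x"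
    by (simp add: algebra_simps power2_eq_square)
  show ?thesis
    apply (simp add: * sum.distrib)
    apply (simp flip: sum_distrib_left add: mult.assoc)
    apply (simp add: algebra_simps power2_eq_square)
    done
qed

text \<open>Within one multiple of \<open>sqrt n\<close> of the mean, the chi-square exponent is at
  most \<open>1 / \<delta>\<^sup>2\<close>, because
  \<open>x * (1 - x) \<ge> \<delta>\<^sup>2\<close>. The assumption
  \<open>1 < \<delta> * sqrt n\<close> keeps \<open>k\<close> strictly between 0 and
  \<open>n\<close>, where the Stirling bounds apply.\<close>

lemma Bernstein_local_lower:
  fixes \<delta> :: real
  assumes "0 < \<delta>" "\<delta> \<le> x" "\<delta> \<le> 1 - x" and n: "1 < \<delta> * sqrt (real n)"
    and k: "(real k - real n * x)\<^sup>2 \<le> real n"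
  shows "exp (- 2 - 1 / \<delta>\<^sup>2) / sqrt (real n) \<le> Bernstein n k x"
proof -
  have n0: "0 < n"
    using n by (cases "n = 0") auto
  have sq: "\<bar>real k - real n * x\<bar> \<le> sqrt (real n)"
    using k by (simp add: real_le_rsqrt)
  have big: "sqrt (real n) < \<delta> * real n"
  proof -
    have "1 * sqrt (real n) < \<delta> * sqrt (real n) * sqrt (real n)"
      using n n0 by (intro mult_strict_right_mono) auto
    then show ?thesis by (simp add: mult.assoc)
  qed
  have d: "\<delta> * real n \<le> x * real n" "\<delta> * real n \<le> (1 - x) * real n"
    using assms by (auto intro: mult_right_mono)
  have "0 < real k" "real k < real n"
    using sq big d unfolding abs_le_iff by (simp_all only: left_diff_distrib mult.commute[of "real n"]) linarith+
  then have k': "0 < k" "k < n" by auto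
  have "sqrt (real k) * sqrt (real (n - k)) \<le> sqrt (real n) * sqrt (real n)"
    using k' by (intro mult_mono) auto
  then have s: "1 / sqrt (real n) \<le> sqrt (real n) / (sqrt (real k) * sqrt (real (n - k)))"
    using k' n0 by (simp add: field_simps)
  have "real n * (\<delta> * \<delta>) \<le> real n * (x * (1 - x))"
    using assms by (intro mult_left_mono mult_mono) auto
  then have "(real k - real n * x)\<^sup>2 / (real n * x * (1 - x)) \<le> real n / (real n * \<delta>\<^sup>2)"
    using k n0 assms by (intro frac_le) (auto simp: power2_eq_square mult.assoc)
  then have e: "(real k - real n * x)\<^sup>2 / (real n * x * (1 - x)) \<le> 1 / \<delta>\<^sup>2"
    using n0 by simp
  have "exp (- 2 - 1 / \<delta>\<^sup>2) / sqrt (real n) = exp (- 2) * (1 / sqrt (real n)) * exp (- (1 / \<delta>\<^sup>2))"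
    by (simp add: exp_diff exp_minus field_simps)
  also have "\<dots> \<le> exp (- 2) * (sqrt (real n) / (sqrt (real k) * sqrt (real (n - k))))
    * exp (- ((real k - real n * x)\<^sup>2 / (real n * x * (1 - x))))"
    using s e by (intro mult_mono) auto
  also have "\<dots> \<le> Bernstein n k x"
    using assms k' by (intro Bernstein_ge_stirling) auto
  finally show ?thesis .
qed

text \<open>If \<open>k\<close> and \<open>n - k\<close> are both at least
  \<open>\<delta> * n / 2\<close>, the Stirling prefactor is of order \<open>1 / sqrt n\<close>;
  otherwise \<open>k\<close> is linearly far from the mean. The two summands of the constant belong
  to these two cases.\<close>

lemma Bernstein_le_inverse_sqrt:
  fixes \<delta> :: real
  assumes "0 < \<delta>" "\<delta> \<le> x" "\<delta> \<le> 1 - x" and n: "0 < n" and k: "k \<le> n"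
  shows "Bernstein n k x \<le> (2 * exp 1 / \<delta> + 4 / \<delta>\<^sup>2) / sqrt (real n)"
proof (cases "\<delta> / 2 * real n \<le> real k \<and> \<delta> / 2 * real n \<le> real (n - k)")
  case True
  have "0 < \<delta> / 2 * real n" using assms by simp
  then have k': "0 < k" "k < n" using True by (auto intro!: Nat.gr0I)
  have "sqrt (\<delta> / 2 * real n) * sqrt (\<delta> / 2 * real n) \<le> sqrt (real k) * sqrt (real (n - k))"
    using True assms by (intro mult_mono) auto
  then have "\<delta> / 2 * real n \<le> sqrt (real k) * sqrt (real (n - k))"
    using assms by simp
  then have "sqrt (real n) / (sqrt (real k) * sqrt (real (n - k))) \<le> sqrt (real n) / (\<delta> / 2 * real n)"
    using assms by (intro divide_left_mono) (auto simp: k')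
  also have "\<dots> = 2 / \<delta> / sqrt (real n)"
    using n assms by (simp add: field_simps)
  finally have "exp 1 * (sqrt (real n) / (sqrt (real k) * sqrt (real (n - k)))) \<le> exp 1 * (2 / \<delta> / sqrt (real n))"
    by (intro mult_left_mono) auto
  then have "Bernstein n k x \<le> exp 1 * (2 / \<delta> / sqrt (real n))"
    using Bernstein_le_stirling[of k n x] k' assms by auto
  also have "\<dots> \<le> (2 * exp 1 / \<delta> + 4 / \<delta>\<^sup>2) / sqrt (real n)"
    using assms by (simp add: add_divide_distrib mult.commute)
  finally show ?thesis .
next
  case False
  \<comment> \<open>Away from the mean Chebyshev's inequality is already strong enough.\<close>
  have d: "\<delta> * real n \<le> x * real n" "\<delta> * real n \<le> (1 - x) * real n"
    using assms by (auto intro: mult_right_mono)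
  have "\<delta> / 2 * real n \<le> \<bar>real k - real n * x\<bar>"
    using False d k by (auto simp: algebra_simps of_nat_diff)
  then have "(\<delta> / 2 * real n)\<^sup>2 \<le> (real k - real n * x)\<^sup>2"
    using assms by (metis abs_ge_zero abs_of_nonneg divide_nonneg_nonneg less_eq_real_def mult_nonneg_nonneg of_nat_0_le_iff power2_abs power_mono zero_le_numeral)
  then have "(\<delta> / 2 * real n)\<^sup>2 * Bernstein n k x \<le> (real k - real n * x)\<^sup>2 * Bernstein n k x"
    using assms by (intro mult_right_mono Bernstein_nonneg) auto
  also have "\<dots> \<le> (\<Sum>k\<le>n. (real k - real n * x)\<^sup>2 * Bernstein n k x)"
    using k assms by (intro member_le_sum) (auto intro!: mult_nonneg_nonneg Bernstein_nonneg)
  also have "\<dots> = real n * (x * (1 - x))"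
    by (simp add: sum_Bernstein_variance)
  also have "\<dots> \<le> real n * (1 * 1)"
    using assms by (intro mult_left_mono mult_mono) auto
  finally have "Bernstein n k x \<le> 4 / \<delta>\<^sup>2 / real n"
    using n assms by (simp add: field_simps power2_eq_square)
  also have "\<dots> \<le> 4 / \<delta>\<^sup>2 / sqrt (real n)"
    using n assms by (intro divide_left_mono) (auto simp: real_sqrt_le_iff intro!: real_le_lsqrt self_le_power)
  also have "\<dots> \<le> (2 * exp 1 / \<delta> + 4 / \<delta>\<^sup>2) / sqrt (real n)"
    using assms by (intro divide_right_mono) auto
  finally show ?thesis .
qed

subsection \<open>The expected number of minimal edges\<close>

text \<open>Intersecting with the supports makes both sets countable, so that the product rule
  \<open>measure_pmf_prob_product\<close> applies.\<close>

lemma prob_pair_pmf_Times: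
  "measure_pmf.prob (pair_pmf M N) (A \<times> B) = measure_pmf.prob M A * measure_pmf.prob N B"
proof -
  have "measure_pmf.prob (pair_pmf M N) (A \<times> B)
      = measure_pmf.prob (pair_pmf M N) ((A \<inter> set_pmf M) \<times> (B \<inter> set_pmf N))"
    by (subst (1 2) measure_Int_set_pmf[symmetric]) (auto intro!: arg_cong[where f = "measure_pmf.prob _"])
  also have "\<dots> = measure_pmf.prob M (A \<inter> set_pmf M) * measure_pmf.prob N (B \<inter> set_pmf N)"
    by (rule measure_pmf_prob_product) (auto intro: countable_Int2)
  finally show ?thesis
    by (simp add: measure_Int_set_pmf)
qed

lemma prob_replicate_pmf_ball:
  "measure_pmf.prob (replicate_pmf m M) {xs. \<forall>x\<in>set xs. P x} = measure_pmf.prob M {x. P x} ^ m"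
proof (induction m)
  case (Suc m)
  have "replicate_pmf (Suc m) M = map_pmf (\<lambda>(x, xs). x # xs) (pair_pmf M (replicate_pmf m M))"
    by (simp add: pair_pmf_def map_bind_pmf)
  then have "measure_pmf.prob (replicate_pmf (Suc m) M) {xs. \<forall>x\<in>set xs. P x}
      = measure_pmf.prob (pair_pmf M (replicate_pmf m M)) ({x. P x} \<times> {xs. \<forall>x\<in>set xs. P x})"
    by (simp only: measure_map_pmf) (auto intro!: arg_cong[where f = "measure_pmf.prob _"])
  also have "\<dots> = measure_pmf.prob M {x. P x} * measure_pmf.prob (replicate_pmf m M) {xs. \<forall>x\<in>set xs. P x}"
    by (rule prob_pair_pmf_Times)
  finally show ?case
    using Suc by simp
qed (simp add: indicator_def)

lemma prob_random_edge_subset: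
  assumes "0 \<le> p" "p \<le> 1" "S \<subseteq> {1..n}"
  shows "measure_pmf.prob (random_edge n p) {e. e \<subseteq> S} = (1 - p) ^ (n - card S)"
proof -
  let ?B = "\<lambda>v. if v \<in> S then UNIV else {False}"
  have "measure_pmf.prob (random_edge n p) {e. e \<subseteq> S}
      = measure_pmf.prob (Pi_pmf {1..n} False (\<lambda>_. bernoulli_pmf p)) (Pi {1..n} ?B)"
    unfolding random_edge_def measure_map_pmf
    by (intro arg_cong[where f = "measure_pmf.prob _"]) (auto simp: Pi_def split: if_splits)
  also have "\<dots> = (\<Prod>v\<in>{1..n}. measure_pmf.prob (bernoulli_pmf p) (?B v))"
    by (rule measure_Pi_pmf_Pi) simp
  also have "\<dots> = (\<Prod>v\<in>{1..n}. if v \<in> S then 1 else 1 - p)"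
    using assms by (intro prod.cong) (auto simp: measure_pmf_single)
  also have "\<dots> = (1 - p) ^ card ({1..n} - S)"
    by (simp add: prod.If_cases Diff_eq)
  also have "card ({1..n} - S) = n - card S"
    using assms(3) by (simp add: card_Diff_subset finite_subset)
  finally show ?thesis .
qed

lemma pmf_random_edge:
  assumes "0 \<le> p" "p \<le> 1" "S \<subseteq> {1..n}"
  shows "pmf (random_edge n p) S = p ^ card S * (1 - p) ^ (n - card S)"
proof -
  have "pmf (random_edge n p) S
      = measure_pmf.prob (Pi_pmf {1..n} False (\<lambda>_. bernoulli_pmf p)) (Pi {1..n} (\<lambda>v. {v \<in> S}))"
    unfolding random_edge_def pmf_map
    using assms(3) by (intro arg_cong[where f = "measure_pmf.prob _"]) (fastforce simp: Pi_def)
  also have "\<dots> = (\<Prod>v\<in>{1..n}. measure_pmf.prob (bernoulli_pmf p) {v \<in> S})"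
    by (rule measure_Pi_pmf_Pi) simp
  also have "\<dots> = (\<Prod>v\<in>{1..n}. if v \<in> S then p else 1 - p)"
    using assms by (intro prod.cong) (auto simp: measure_pmf_single)
  also have "\<dots> = p ^ card S * (1 - p) ^ card ({1..n} - S)"
    using assms(3) by (simp add: prod.If_cases Diff_eq Int_absorb1)
  also have "card ({1..n} - S) = n - card S"
    using assms(3) by (simp add: card_Diff_subset finite_subset)
  finally show ?thesis .
qed

lemma prob_random_edge_psubset:
  assumes "0 \<le> p" "p \<le> 1" "S \<subseteq> {1..n}"
  shows "measure_pmf.prob (random_edge n p) {e. e \<subset> S}
    = (1 - p) ^ (n - card S) - p ^ card S * (1 - p) ^ (n - card S)"
proof -
  have "{e. e \<subset> S} = {e. e \<subseteq> S} - {S}"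
    by auto
  moreover have "measure_pmf.prob (random_edge n p) ({e. e \<subseteq> S} - {S})
      = measure_pmf.prob (random_edge n p) {e. e \<subseteq> S} - measure_pmf.prob (random_edge n p) {S}"
    by (intro measure_pmf.finite_measure_Diff) auto
  ultimately show ?thesis
    using assms by (simp add: prob_random_edge_subset pmf_random_edge measure_pmf_single)
qed

text \<open>\<open>S\<close> is a minimal edge iff no sample is a proper subset of \<open>S\<close>
  while some sample is a subset of \<open>S\<close>, hence equal to it. This is a difference of
  nested events, each of which asks the same of all \<open>m\<close> independent samples.\<close>

lemma prob_in_minimization:
  assumes "0 \<le> p" "p \<le> 1" "S \<subseteq> {1..n}"
  defines "b \<equiv> (1 - p) ^ (n - card S)"
  shows "measure_pmf.prob (random_hypergraph n m p) {H. S \<in> minimization H}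
    = (1 - b + p ^ card S * b) ^ m - (1 - b) ^ m"
proof -
  let ?R = "replicate_pmf m (random_edge n p)"
  have "measure_pmf.prob (random_hypergraph n m p) {H. S \<in> minimization H}
      = measure_pmf.prob ?R ({es. \<forall>e\<in>set es. \<not> e \<subset> S} - {es. \<forall>e\<in>set es. \<not> e \<subseteq> S})"
    unfolding random_hypergraph_def measure_map_pmf
    by (intro arg_cong[where f = "measure_pmf.prob _"]) (auto simp: minimization_def)
  also have "\<dots> = measure_pmf.prob ?R {es. \<forall>e\<in>set es. \<not> e \<subset> S}
      - measure_pmf.prob ?R {es. \<forall>e\<in>set es. \<not> e \<subseteq> S}"
    by (intro measure_pmf.finite_measure_Diff) auto
  also have "\<dots> = measure_pmf.prob (random_edge n p) (- {e. e \<subset> S}) ^ m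
      - measure_pmf.prob (random_edge n p) (- {e. e \<subseteq> S}) ^ m"
    unfolding prob_replicate_pmf_ball by (simp add: Collect_neg_eq)
  also have "\<dots> = (1 - b + p ^ card S * b) ^ m - (1 - b) ^ m"
    using assms by (simp add: measure_pmf.prob_compl[unfolded space_measure_pmf, simplified, folded Compl_eq_Diff_UNIV]
        prob_random_edge_subset prob_random_edge_psubset algebra_simps)
  finally show ?thesis .
qed

lemma sum_Pow_card:
  fixes g :: "nat \<Rightarrow> real"
  assumes "finite A"
  shows "(\<Sum>S\<in>Pow A. g (card S)) = (\<Sum>k\<le>card A. real (card A choose k) * g k)"
proof -
  have "(\<Sum>S\<in>Pow A. g (card S)) = (\<Sum>k\<le>card A. \<Sum>S\<in>{S \<in> Pow A. card S = k}. g (card S))"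
    using assms by (intro sum.group[symmetric]) (auto intro: card_mono)
  also have "\<dots> = (\<Sum>k\<le>card A. real (card A choose k) * g k)"
    using assms by (intro sum.cong) (auto simp: n_subsets)
  finally show ?thesis .
qed

lemma random_edge_subset: "e \<in> set_pmf (random_edge n p) \<Longrightarrow> e \<subseteq> {1..n}"
  by (auto simp: random_edge_def)

lemma edge_of_random_hypergraph:
  "H \<in> set_pmf (random_hypergraph n m p) \<Longrightarrow> e \<in># H \<Longrightarrow> e \<in> set_pmf (random_edge n p)"
  by (auto simp: random_hypergraph_def set_replicate_pmf)

lemma minimization_subset_Pow:
  "H \<in> set_pmf (random_hypergraph n m p) \<Longrightarrow> minimization H \<subseteq> Pow {1..n}"
  using edge_of_random_hypergraph random_edge_subset by (fastforce simp: minimization_def)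

text \<open>Linearity of expectation over the indicators of all \<open>S \<subseteq> {1..n}\<close>;
  the probabilities depend only on \<open>card S\<close>, so the sets are grouped by size.\<close>

lemma expected_min_eq:
  assumes "0 \<le> p" "p \<le> 1"
  shows "expected_min n m p = (\<Sum>k\<le>n. real (n choose k) *
    ((1 - (1 - p) ^ (n - k) + p ^ k * (1 - p) ^ (n - k)) ^ m - (1 - (1 - p) ^ (n - k)) ^ m))"
proof -
  let ?H = "random_hypergraph n m p"
  have "expected_min n m p
      = measure_pmf.expectation ?H (\<lambda>H. \<Sum>S\<in>Pow {1..n}. indicator {H. S \<in> minimization H} H)"
    unfolding expected_min_def
  proof (intro integral_cong_AE AE_pmfI)
    fix H assume H: "H \<in> set_pmf ?H"
    have "card (minimization H) = card {S \<in> Pow {1..n}. S \<in> minimization H}"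
      using minimization_subset_Pow[OF H] by (intro arg_cong[where f = card]) auto
    then show "real (card (minimization H)) = (\<Sum>S\<in>Pow {1..n}. indicator {H. S \<in> minimization H} H)"
      by (simp add: indicator_def sum.If_cases Int_def)
  qed auto
  also have "\<dots> = (\<Sum>S\<in>Pow {1..n}. measure_pmf.prob ?H {H. S \<in> minimization H})"
    by (subst Bochner_Integration.integral_sum) (auto intro: measure_pmf.integrable_const_bound[where B = 1])
  also have "\<dots> = (\<Sum>S\<in>Pow {1..n}.
    (1 - (1 - p) ^ (n - card S) + p ^ card S * (1 - p) ^ (n - card S)) ^ m - (1 - (1 - p) ^ (n - card S)) ^ m)"
    using assms by (intro sum.cong prob_in_minimization) auto
  finally show ?thesis
    using sum_Pow_card[of "{1..n}"] by simp
qed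

lemma minimization_nonempty:
  assumes "H \<noteq> {#}" "\<And>e. e \<in># H \<Longrightarrow> finite e"
  shows "minimization H \<noteq> {}"
proof -
  have "finite (set_mset H)" "set_mset H \<noteq> {}"
    using assms by auto
  from finite_has_minimal[OF this] show ?thesis
    by (auto simp: minimization_def psubset_eq)
qed

text \<open>A nonempty finite family of finite sets has a minimal member, so the count is at least 1
  almost surely; it is integrable since it never exceeds the number of subsets of
  \<open>{1..n}\<close>.\<close>

lemma expected_min_ge_1:
  assumes "0 < m"
  shows "1 \<le> expected_min n m p"
proof -
  let ?H = "random_hypergraph n m p"
  have fin: "finite (minimization H)" if "H \<in> set_pmf ?H" for H
    using minimization_subset_Pow[OF that] by (rule finite_subset) auto
  have int: "integrable ?H (\<lambda>H. real (card (minimization H)))"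
  proof (intro measure_pmf.integrable_const_bound[where B = "real (card (Pow {1..n}))"] AE_pmfI)
    fix H assume "H \<in> set_pmf ?H"
    then show "norm (real (card (minimization H))) \<le> real (card (Pow {1..n}))"
      using card_mono[OF _ minimization_subset_Pow[of H n m p]] by (simp del: card_Pow)
  qed simp
  have "1 \<le> real (card (minimization H))" if H: "H \<in> set_pmf ?H" for H
  proof -
    have "H \<noteq> {#}"
      using H assms by (auto simp: random_hypergraph_def set_replicate_pmf)
    moreover have "finite e" if "e \<in># H" for e
      using random_edge_subset[OF edge_of_random_hypergraph[OF H that]] by (rule finite_subset) auto
    ultimately have "minimization H \<noteq> {}"
      by (rule minimization_nonempty)
    then show ?thesis
      using fin[OF H] by (simp add: Suc_le_eq card_gt_0_iff)
  qed
  then have "measure_pmf.expectation ?H (\<lambda>_. 1) \<le> expected_min n m p"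
    unfolding expected_min_def by (intro integral_mono_AE int AE_pmfI) auto
  then show ?thesis
    by simp
qed

lemma card_minimization_degenerate:
  assumes "p = 0 \<or> p = 1" "0 < m" "H \<in> set_pmf (random_hypergraph n m p)"
  shows "card (minimization H) = 1"
proof -
  have "set_pmf (bernoulli_pmf 0) \<subseteq> {False}" "set_pmf (bernoulli_pmf 1) \<subseteq> {True}"
    by (auto simp: set_pmf_eq split: bool.splits) (metis (full_types) pmf_bernoulli_True pmf_bernoulli_False diff_self order_refl zero_le_one)+
  \<comment> \<open>\<open>w\<close> is the constant outcome of the degenerate coin: every sample is
    then the empty set or every sample is all of \<open>{1..n}\<close>.\<close>
  then have "\<exists>w. set_pmf (bernoulli_pmf p) \<subseteq> {w}"
    using assms(1) by blast
  then obtain w where "set_pmf (bernoulli_pmf p) \<subseteq> {w}" ..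
  then have "set_pmf (random_edge n p) \<subseteq> {{v \<in> {1..n}. w}}"
    using set_Pi_pmf_subset'[of "{1..n}" False "\<lambda>_. bernoulli_pmf p"]
    by (fastforce simp: random_edge_def PiE_dflt_def)
  then obtain e0 where e0: "\<And>e. e \<in># H \<Longrightarrow> e = e0"
    using edge_of_random_hypergraph[OF assms(3)] by blast
  have "H \<noteq> {#}"
    using assms by (auto simp: random_hypergraph_def set_replicate_pmf)
  then have "minimization H = {e0}"
    using e0 by (auto simp: minimization_def)
  then show ?thesis by simp
qed

section \<open>Estimates that replace the exact summands by binomial weights\<close>

lemma power_diff_bounds:
  fixes y a :: real
  assumes "0 \<le> y" "0 \<le> a" "0 < m"
  shows "real m * a * y ^ (m - 1) \<le> (y + a) ^ m - y ^ m"
    and "(y + a) ^ m - y ^ m \<le> real m * a * (y + a) ^ (m - 1)"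
proof -
  obtain j where m: "m = Suc j"
    using assms(3) gr0_conv_Suc by auto
  \<comment> \<open>Each of the \<open>m\<close> summands lies between \<open>y ^ j\<close> and
    \<open>(y + a) ^ j\<close>, which yields both bounds.\<close>
  have eq: "(y + a) ^ m - y ^ m = a * (\<Sum>i<m. (y + a) ^ i * y ^ (j - i))"
    unfolding m by (subst power_diff_sumr2) (simp add: mult_ac)
  have "(\<Sum>i<m. y ^ j) \<le> (\<Sum>i<m. (y + a) ^ i * y ^ (j - i))"
  proof (rule sum_mono)
    fix i assume "i \<in> {..<m}"
    then have "y ^ j = y ^ i * y ^ (j - i)" by (simp add: m power_add[symmetric])
    also have "\<dots> \<le> (y + a) ^ i * y ^ (j - i)"
      using assms by (intro mult_right_mono power_mono) auto
    finally show "y ^ j \<le> (y + a) ^ i * y ^ (j - i)" .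
  qed
  then have "a * (\<Sum>i<m. y ^ j) \<le> a * (\<Sum>i<m. (y + a) ^ i * y ^ (j - i))"
    using assms by (intro mult_left_mono)
  then show "real m * a * y ^ (m - 1) \<le> (y + a) ^ m - y ^ m"
    unfolding eq by (simp add: m mult_ac)
  have "(\<Sum>i<m. (y + a) ^ i * y ^ (j - i)) \<le> (\<Sum>i<m. (y + a) ^ j)"
  proof (rule sum_mono)
    fix i assume "i \<in> {..<m}"
    have "(y + a) ^ i * y ^ (j - i) \<le> (y + a) ^ i * (y + a) ^ (j - i)"
      using assms by (intro mult_left_mono power_mono) auto
    also have "\<dots> = (y + a) ^ j" using \<open>i \<in> {..<m}\<close> by (simp add: m power_add[symmetric])
    finally show "(y + a) ^ i * y ^ (j - i) \<le> (y + a) ^ j" .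
  qed
  then have "a * (\<Sum>i<m. (y + a) ^ i * y ^ (j - i)) \<le> a * (\<Sum>i<m. (y + a) ^ j)"
    using assms by (intro mult_left_mono)
  then show "(y + a) ^ m - y ^ m \<le> real m * a * (y + a) ^ (m - 1)"
    unfolding eq by (simp add: m mult_ac)
qed

lemma exp_minus_one_le_power:
  fixes b :: real
  assumes "0 < m" "b \<le> 1 / real m"
  shows "exp (- 1) \<le> (1 - b) ^ (m - 1)"
proof (cases "m = 1")
  case False
  then have m: "2 \<le> m" using assms by simp
  \<comment> \<open>\<open>t\<close> is the reciprocal of \<open>1 - 1 / m\<close>, so the claim
    reduces to \<open>t ^ (m - 1) \<le> exp 1\<close>. For \<open>m = 1\<close> this quotient
    degenerates, but the exponent in the claim is 0.\<close>
  define t where "t = real m / real (m - 1)"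
  have t: "1 / t = 1 - 1 / real m" "0 < t"
    using m by (auto simp: t_def field_simps of_nat_diff)
  have "t ^ (m - 1) \<le> exp (real (m - 1) * (t - 1))"
    using t by (intro power_le_exp_minus_one) auto
  also have "real (m - 1) * (t - 1) = 1"
    using m by (simp add: t_def field_simps of_nat_diff)
  finally have "exp (- 1) \<le> (1 / t) ^ (m - 1)"
    using t by (simp add: exp_minus power_divide field_simps)
  also have "\<dots> \<le> (1 - b) ^ (m - 1)"
    using t assms m by (intro power_mono) auto
  finally show ?thesis .
qed simp

lemma power_le_exp_neg:
  fixes d :: real
  assumes "d \<le> 1"
  shows "(1 - d) ^ j \<le> exp (- (real j * d))"
  using power_le_exp_minus_one[of "1 - d" j] assms by simp

text \<open>On the chosen layers a fixed set of size \<open>k\<close> contains at most one sample in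
  expectation, so the factor \<open>(1 - b) ^ (m - 1)\<close> costs at most a factor e. All other
  layers contribute nonnegatively.\<close>

lemma expected_min_lower:
  assumes p: "0 < p" "p < 1" and m: "0 < m"
    and K: "K \<subseteq> {..n}" "\<And>k. k \<in> K \<Longrightarrow> (1 - p) ^ (n - k) \<le> 1 / real m"
  shows "exp (- 1) * (\<Sum>k\<in>K. real m * Bernstein n k p) \<le> expected_min n m p"
proof -
  let ?b = "\<lambda>k. (1 - p) ^ (n - k)"
  let ?t = "\<lambda>k. real (n choose k) * ((1 - ?b k + p ^ k * ?b k) ^ m - (1 - ?b k) ^ m)"
  have b: "0 \<le> ?b k" "?b k \<le> 1" for k
    using p by (auto intro: power_le_one)
  have "exp (- 1) * (\<Sum>k\<in>K. real m * Bernstein n k p) = (\<Sum>k\<in>K. exp (- 1) * (real m * Bernstein n k p))"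
    by (rule sum_distrib_left)
  also have "\<dots> \<le> (\<Sum>k\<in>K. ?t k)"
  proof (rule sum_mono)
    fix k assume "k \<in> K"
    have "exp (- 1) * (real m * Bernstein n k p)
        = real (n choose k) * (real m * (p ^ k * ?b k) * exp (- 1))"
      by (simp add: Bernstein_def)
    also have "\<dots> \<le> real (n choose k) * (real m * (p ^ k * ?b k) * (1 - ?b k) ^ (m - 1))"
      using K(2)[OF \<open>k \<in> K\<close>] p b m by (intro mult_left_mono exp_minus_one_le_power) auto
    also have "\<dots> \<le> ?t k"
      using p b m by (intro mult_left_mono power_diff_bounds) auto
    finally show "exp (- 1) * (real m * Bernstein n k p) \<le> ?t k" .
  qed
  also have "\<dots> \<le> (\<Sum>k\<le>n. ?t k)"
    using K(1) p b by (intro sum_mono2) (auto intro!: mult_nonneg_nonneg power_mono)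
  finally show ?thesis
    using p by (simp add: expected_min_eq)
qed

text \<open>\<open>y\<close> is a free cutoff below which the decay factor is bounded by 1. Above it
  \<open>k \<ge> 1\<close>, so \<open>p ^ k \<le> p\<close> gives the factor \<open>1 - p\<close> in
  the exponent, and \<open>m \<ge> 2\<close> gives the factor \<open>1/2\<close> through
  \<open>m - 1 \<ge> m / 2\<close>.\<close>

lemma expected_min_upper:
  assumes p: "0 < p" "p < 1" and m: "2 \<le> m" and y: "0 \<le> y"
  shows "expected_min n m p \<le> (\<Sum>k\<le>n. real m * Bernstein n k p *
    (if real k \<le> y then 1 else exp (- ((1 - p) / 2 * (real m * (1 - p) ^ (n - k))))))"
  unfolding expected_min_eq[OF less_imp_le[OF p(1)] less_imp_le[OF p(2)]]
proof (rule sum_mono)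
  fix k assume "k \<in> {..n}"
  define b where "b = (1 - p) ^ (n - k)"
  have b: "0 \<le> b" "b \<le> 1"
    using p by (auto simp: b_def intro: power_le_one)
  have pk: "0 \<le> p ^ k" "p ^ k \<le> 1"
    using p by (auto intro: power_le_one)
  then have "p ^ k * b \<le> 1 * b" "p ^ k * b \<le> 1"
    using b by (auto intro: mult_left_le_one_le mult_le_one)
  then have pb: "0 \<le> b - p ^ k * b" "b - p ^ k * b \<le> 1"
    using b pk by (auto intro: order_trans[OF _ b(2)])
  have "(1 - b + p ^ k * b) ^ m - (1 - b) ^ m \<le> real m * (p ^ k * b) * (1 - (b - p ^ k * b)) ^ (m - 1)"
    using power_diff_bounds(2)[of "1 - b" "p ^ k * b" m] b pk m by (simp add: diff_diff_eq2 diff_add_eq)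
  also have "\<dots> \<le> real m * (p ^ k * b) * (if real k \<le> y then 1 else exp (- ((1 - p) / 2 * (real m * b))))"
  proof (intro mult_left_mono)
    show "(1 - (b - p ^ k * b)) ^ (m - 1) \<le> (if real k \<le> y then 1 else exp (- ((1 - p) / 2 * (real m * b))))"
    proof (cases "real k \<le> y")
      case True
      then show ?thesis using pb by (simp add: power_le_one)
    next
      case False
      then have "0 < k" using y by (auto intro!: Nat.gr0I)
      then have "p ^ k \<le> p ^ 1"
        using p by (intro power_decreasing) auto
      then have "p ^ k * b \<le> p * b"
        using b by (intro mult_right_mono) auto
      then have "real m / 2 * ((1 - p) * b) \<le> real (m - 1) * (b - p ^ k * b)"
        using p b m by (intro mult_mono) (auto simp: algebra_simps intro: mult_right_le_one_le)
      then have "exp (- (real (m - 1) * (b - p ^ k * b))) \<le> exp (- ((1 - p) / 2 * (real m * b)))"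
        by (simp add: field_simps)
      then show ?thesis
        using order_trans[OF power_le_exp_neg[OF pb(2), of "m - 1"]] False by simp
    qed
  qed (use b pk in auto)
  finally have "real (n choose k) * ((1 - b + p ^ k * b) ^ m - (1 - b) ^ m)
      \<le> real (n choose k) * (real m * (p ^ k * b) * (if real k \<le> y then 1 else exp (- ((1 - p) / 2 * (real m * b)))))"
    by (intro mult_left_mono) auto
  then show "real (n choose k) * ((1 - (1 - p) ^ (n - k) + p ^ k * (1 - p) ^ (n - k)) ^ m - (1 - (1 - p) ^ (n - k)) ^ m)
     \<le> real m * Bernstein n k p *
    (if real k \<le> y then 1 else exp (- ((1 - p) / 2 * (real m * (1 - p) ^ (n - k)))))"
    unfolding Bernstein_def b_def by (simp only: mult_ac of_nat_id)
qed

text \<open>Bounding the decay factor by 1 leaves \<open>m\<close> times binomial weights, which sum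
  to 1.\<close>

lemma expected_min_le:
  assumes p: "0 < p" "p < 1" and m: "0 < m"
  shows "expected_min n m p \<le> real m"
proof -
  have "expected_min n m p \<le> (\<Sum>k\<le>n. real m * Bernstein n k p)"
    unfolding expected_min_eq[OF less_imp_le[OF p(1)] less_imp_le[OF p(2)]]
  proof (rule sum_mono)
    fix k
    define b where "b = (1 - p) ^ (n - k)"
    have b: "0 \<le> b" "b \<le> 1" and pk: "0 \<le> p ^ k" "p ^ k \<le> 1"
      using p by (auto simp: b_def intro: power_le_one)
    then have pb: "p ^ k * b \<le> 1 * b"
      by (intro mult_right_mono) auto
    have "(1 - b + p ^ k * b) ^ m - (1 - b) ^ m \<le> real m * (p ^ k * b) * (1 - b + p ^ k * b) ^ (m - 1)"
      using b pk m by (intro power_diff_bounds) auto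
    also have "\<dots> \<le> real m * (p ^ k * b) * 1"
      using b pk pb by (intro mult_left_mono power_le_one) auto
    finally have "real (n choose k) * ((1 - b + p ^ k * b) ^ m - (1 - b) ^ m) \<le> real (n choose k) * (real m * (p ^ k * b))"
      by (intro mult_left_mono) auto
    then show "real (n choose k) * ((1 - (1 - p) ^ (n - k) + p ^ k * (1 - p) ^ (n - k)) ^ m - (1 - (1 - p) ^ (n - k)) ^ m)
      \<le> real m * Bernstein n k p"
      by (simp add: Bernstein_def b_def mult_ac)
  qed
  also have "\<dots> = real m"
    by (simp add: sum_distrib_left[symmetric])
  finally show ?thesis .
qed

text \<open>The empty set contributes at most 1. A nonempty set is minimal only if no sample is a
  proper subset of it; a sample is one with probability at least
  \<open>(1 - p) * (1 - p) ^ n\<close>. The factor \<open>2 ^ n\<close> is a union bound over all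
  sets.\<close>

lemma expected_min_le_1_plus:
  assumes p: "0 < p" "p < 1"
  shows "expected_min n m p \<le> 1 + 2 ^ n * exp (- (real m * ((1 - p) * (1 - p) ^ n)))"
proof -
  let ?q = "1 - p"
  let ?E = "exp (- (real m * (?q * ?q ^ n)))"
  have "expected_min n m p \<le> (\<Sum>k\<le>n. (if k = 0 then 1 else 0) + real (n choose k) * ?E)"
    unfolding expected_min_eq[OF less_imp_le[OF p(1)] less_imp_le[OF p(2)]]
  proof (rule sum_mono)
    fix k
    define b where "b = ?q ^ (n - k)"
    have b: "0 \<le> b" "b \<le> 1"
      using p by (auto simp: b_def intro: power_le_one)
    show "real (n choose k) * ((1 - ?q ^ (n - k) + p ^ k * ?q ^ (n - k)) ^ m - (1 - ?q ^ (n - k)) ^ m)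
        \<le> (if k = 0 then 1 else 0) + real (n choose k) * ?E"
    proof (cases "k = 0")
      case True
      then have "0 \<le> (1 - ?q ^ n) ^ m"
        using b by (simp add: b_def)
      moreover have "0 \<le> ?E" by simp
      ultimately have "- ((1 - ?q ^ n) ^ m) \<le> ?E" by linarith
      then show ?thesis
        using True by simp
    next
      case False
      then have pk: "0 \<le> p ^ k" "p ^ k \<le> p ^ 1"
        using p False by (simp, intro power_decreasing) auto
      then have pb: "p ^ k * b \<le> p * b" "0 \<le> p ^ k * b"
        using b by (auto intro: mult_right_mono)
      have "?q ^ n \<le> b"
        using p by (auto simp: b_def intro: power_decreasing)
      then have "?q * ?q ^ n \<le> ?q * b"
        using p by (intro mult_left_mono) auto
      then have d: "?q * ?q ^ n \<le> b - p ^ k * b"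
        using pb by (simp add: algebra_simps)
      have "1 - b + p ^ k * b = 1 - (b - p ^ k * b)"
        by simp
      then have "(1 - b + p ^ k * b) ^ m - (1 - b) ^ m \<le> (1 - (b - p ^ k * b)) ^ m"
        using b by (simp only:) simp
      also have "\<dots> \<le> exp (- (real m * (b - p ^ k * b)))"
        using b pb by (intro power_le_exp_neg) auto
      also have "\<dots> \<le> ?E"
        using d by (simp add: mult_left_mono)
      finally have "real (n choose k) * ((1 - b + p ^ k * b) ^ m - (1 - b) ^ m) \<le> real (n choose k) * ?E"
        by (intro mult_left_mono) auto
      then show ?thesis
        using False by (simp add: b_def)
    qed
  qed
  also have "\<dots> = 1 + real (\<Sum>k\<le>n. n choose k) * ?E"
    by (simp add: sum.distrib sum_distrib_right[symmetric] del: sum.lessThan_Suc)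
  also have "(\<Sum>k\<le>n. n choose k) = 2 ^ n"
    by (rule choose_row_sum)
  finally show ?thesis by simp
qed

lemma sqrt_eventually_gt: "\<exists>N. \<forall>n\<ge>N. M < sqrt (real n)"
proof -
  have "filterlim (\<lambda>n. sqrt (real n)) at_top sequentially"
    by real_asymp
  then show ?thesis
    by (simp add: filterlim_at_top_dense eventually_sequentially)
qed

subsection \<open>Few edges\<close>

text \<open>About \<open>sqrt n\<close> layers just below the mean \<open>p * n\<close> have weight
  of order \<open>1 / sqrt n\<close> each, so together they carry a constant fraction of the
  distribution. They satisfy \<open>n - k \<ge> (1 - p) * n\<close>, which is what the bound on
  \<open>m\<close> needs to keep \<open>m * (1 - p) ^ (n - k)\<close> at most 1.\<close>

lemma expected_min_small_m:
  assumes p: "0 < p" "p < 1"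
  shows "\<exists>c>0. \<exists>N. \<forall>n\<ge>N. \<forall>m>0. real m \<le> 1 / (1 - p) powr ((1 - p) * real n) \<longrightarrow>
    c * real m \<le> expected_min n m p"
proof -
  define \<delta> where "\<delta> = min p (1 - p)"
  have \<delta>: "0 < \<delta>" "\<delta> \<le> p" "\<delta> \<le> 1 - p"
    using p by (auto simp: \<delta>_def)
  define d where "d = exp (- 2 - 1 / \<delta>\<^sup>2)"
  have d: "0 < d" by (simp add: d_def)
  \<comment> \<open>The summand \<open>1 / \<delta>\<close> makes the local lower bound applicable;
    the summand 2 absorbs the rounding of both interval ends, leaving at least
    \<open>sqrt n / 2\<close> integers.\<close>
  obtain N where N: "\<And>n. n \<ge> N \<Longrightarrow> 1 / \<delta> + 2 < sqrt (real n)"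
    using sqrt_eventually_gt by blast
  have "exp (- 1) * d / 2 * real m \<le> expected_min n m p"
    if "n \<ge> N" "0 < m" and mle: "real m \<le> 1 / (1 - p) powr ((1 - p) * real n)" for n m
  proof -
    let ?s = "sqrt (real n)"
    have s: "1 / \<delta> < ?s" "2 < ?s"
      using N[OF \<open>n \<ge> N\<close>] divide_pos_pos[OF zero_less_one \<delta>(1)] by linarith+
    have ds: "1 < \<delta> * ?s"
      using s \<delta> by (simp add: field_simps)
    have "1 * ?s \<le> (\<delta> * ?s) * ?s"
      using ds s by (intro mult_right_mono) auto
    then have "?s \<le> \<delta> * real n"
      by (simp add: mult.assoc)
    also have "\<dots> \<le> p * real n"
      using \<delta> by (intro mult_right_mono) auto
    finally have sp: "0 \<le> p * real n - ?s" by simp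
    define u where "u = nat \<lceil>p * real n - ?s\<rceil>"
    define v where "v = nat \<lfloor>p * real n\<rfloor>"
    have u: "p * real n - ?s \<le> real u" "real u < p * real n - ?s + 1"
      using sp by (simp_all add: u_def) linarith+
    have v: "real v \<le> p * real n" "p * real n < real v + 1"
      using p by (simp_all add: v_def)
    have kprops: "(real k - real n * p)\<^sup>2 \<le> real n \<and> k \<le> n \<and> (1 - p) ^ (n - k) \<le> 1 / real m"
      if k: "k \<in> {u..v}" for k
    proof -
      have k1: "p * real n - ?s \<le> real k" "real k \<le> p * real n"
        using k u v by auto
      then have "\<bar>real k - real n * p\<bar> \<le> ?s"
        by (simp add: abs_le_iff mult.commute)
      then have a: "(real k - real n * p)\<^sup>2 \<le> real n"
        by (simp add: sqrt_ge_absD)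
      have "p * real n \<le> 1 * real n"
        using p by (intro mult_right_mono) auto
      then have b: "k \<le> n"
        using k1 by simp
      have "(1 - p) ^ (n - k) = (1 - p) powr (real n - real k)"
        using p b by (simp add: powr_realpow[symmetric] of_nat_diff)
      also have "\<dots> \<le> (1 - p) powr ((1 - p) * real n)"
        using p k1 by (intro powr_mono') (auto simp: algebra_simps)
      also have "\<dots> \<le> 1 / real m"
        using mle \<open>0 < m\<close> p by (simp add: field_simps)
      finally show ?thesis using a b by simp
    qed
    have "?s / 2 \<le> real v - real u + 1"
      using u v s by linarith
    then have card: "?s / 2 \<le> real (card {u..v})"
      using s by (cases "u \<le> Suc v") (auto simp: of_nat_diff)
    have s0: "0 < ?s"
      using s(2) by linarith
    then have "d / 2 = ?s / 2 * (d / ?s)"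
      by simp
    also have "\<dots> \<le> real (card {u..v}) * (d / ?s)"
      using card s0 d by (intro mult_right_mono) auto
    also have "\<dots> = (\<Sum>k\<in>{u..v}. d / ?s)"
      by simp
    also have "\<dots> \<le> (\<Sum>k\<in>{u..v}. Bernstein n k p)"
      unfolding d_def using \<delta> ds kprops by (intro sum_mono Bernstein_local_lower) auto
    finally have "exp (- 1) * (real m * (d / 2)) \<le> exp (- 1) * (real m * (\<Sum>k\<in>{u..v}. Bernstein n k p))"
      by (intro mult_left_mono) auto
    also have "\<dots> = exp (- 1) * (\<Sum>k\<in>{u..v}. real m * Bernstein n k p)"
      by (simp add: sum_distrib_left)
    also have "\<dots> \<le> expected_min n m p"
      using kprops p \<open>0 < m\<close> by (intro expected_min_lower) auto
    finally show ?thesis by (simp add: mult_ac)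
  qed
  then show ?thesis
    using d by (intro exI[of _ "exp (- 1) * d / 2"]) auto
qed

subsection \<open>The intermediate range\<close>

text \<open>The exponential growth rate per vertex, written in
  \<open>x = 1 - \<alpha>\<close>.\<close>

definition entropy_factor :: "real \<Rightarrow> real \<Rightarrow> real" where
  "entropy_factor p x = p powr x / (x powr x * (1 - x) powr (1 - x))"

lemma two_powr_entropy:
  assumes "0 < p" "0 < x" "x < 1"
  shows "2 powr ((binary_entropy (1 - x) + x * log 2 p) * real n) = entropy_factor p x ^ n"
proof -
  have "(binary_entropy (1 - x) + x * log 2 p) * ln 2 = x * ln p - (x * ln x + (1 - x) * ln (1 - x))"
    by (simp add: binary_entropy_def log_def field_simps)
  then have "2 powr (binary_entropy (1 - x) + x * log 2 p) = entropy_factor p x"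
    using assms by (simp add: entropy_factor_def powr_def exp_diff exp_add)
  then show ?thesis
    by (metis powr_powr powr_realpow powr_gt_zero zero_neq_numeral)
qed

text \<open>The quotient of the binomial weights with parameters \<open>p\<close> and
  \<open>x\<close> is geometric in \<open>k\<close>, with the odds ratio as its base. Centring at
  \<open>k = n * x\<close> and multiplying by the edge count leaves the entropy factor.\<close>

lemma Bernstein_exponential_tilting:
  assumes p: "0 < p" "p < 1" and x: "0 < x" "x < 1" and k: "k \<le> n"
  shows "(1 - p) powr (- ((1 - x) * real n)) * Bernstein n k p
    = entropy_factor p x ^ n * Bernstein n k x
      * (p * (1 - x) / (x * (1 - p))) powr (real k - real n * x)"
proof -
  have e: "entropy_factor p x ^ n = exp (real n * (x * ln p - (x * ln x + (1 - x) * ln (1 - x))))"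
    using x p by (simp add: entropy_factor_def powr_def exp_of_nat_mult exp_diff exp_add)
  have pw: "y ^ j = exp (real j * ln y)" if "0 < y" for y :: real and j
    using that by (simp add: exp_of_nat_mult)
  have l: "(p * (1 - x) / (x * (1 - p))) powr (real k - real n * x)
      = exp ((real k - real n * x) * (ln p + ln (1 - x) - (ln x + ln (1 - p))))"
    using p x by (simp add: powr_def ln_mult ln_div)
  have "(1 - p) powr (- ((1 - x) * real n)) * (p ^ k * (1 - p) ^ (n - k))
      = entropy_factor p x ^ n * (x ^ k * (1 - x) ^ (n - k))
      * (p * (1 - x) / (x * (1 - p))) powr (real k - real n * x)"
    unfolding e l using p x k
    by (simp add: powr_def pw exp_add[symmetric] of_nat_diff) (simp add: algebra_simps)
  then show ?thesis
    by (simp add: Bernstein_def mult_ac)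
qed

section \<open>Two-sided geometric sums and double exponential decay\<close>

lemma sum_power_inj_le:
  fixes s :: real
  assumes "0 \<le> s" "s < 1" "finite K" "inj_on f K"
  shows "(\<Sum>k\<in>K. s ^ f k) \<le> 1 / (1 - s)"
proof -
  have "(\<Sum>k\<in>K. s ^ f k) = (\<Sum>j\<in>f ` K. s ^ j)"
    using assms(4) by (simp add: sum.reindex)
  also have "\<dots> \<le> (\<Sum>j. s ^ j)"
    using assms by (intro sum_le_suminf summable_geometric) auto
  also have "\<dots> = 1 / (1 - s)"
    using assms by (intro suminf_geometric) auto
  finally show ?thesis .
qed

lemma sum_powr_abs_le:
  fixes s y :: real
  assumes s: "0 < s" "s < 1" and y: "0 \<le> y"
  shows "(\<Sum>k\<le>n. s powr \<bar>real k - y\<bar>) \<le> 2 / (s * (1 - s))"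
proof -
  define k0 where "k0 = nat \<lfloor>y\<rfloor>"
  have k0: "real k0 \<le> y" "y < real k0 + 1"
    using y by (simp_all add: k0_def)
  \<comment> \<open>Replacing \<open>y\<close> by its floor changes the distance by at most 1, hence
    the division by \<open>s\<close>.\<close>
  have split: "s powr \<bar>real k - y\<bar> \<le> (if k < k0 then s ^ (k0 - k) else s ^ (k - k0)) / s" for k
  proof -
    let ?j = "if k < k0 then k0 - k else k - k0"
    have "s powr \<bar>real k - y\<bar> \<le> s powr (real ?j - 1)"
      using s k0 by (intro powr_mono') (auto simp: of_nat_diff)
    also have "\<dots> = s ^ ?j / s"
      using s by (simp only: powr_diff powr_realpow powr_one less_imp_le)
    finally show ?thesis by (simp split: if_splits)
  qed
  have "(\<Sum>k\<le>n. s powr \<bar>real k - y\<bar>) \<le> (\<Sum>k\<le>n. (if k < k0 then s ^ (k0 - k) else s ^ (k - k0)) / s)"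
    by (intro sum_mono split)
  also have "\<dots> = ((\<Sum>k\<in>{..n} \<inter> {k. k < k0}. s ^ (k0 - k)) + (\<Sum>k\<in>{..n} \<inter> - {k. k < k0}. s ^ (k - k0))) / s"
    by (simp add: sum_divide_distrib[symmetric] sum.If_cases)
  also have "\<dots> \<le> (1 / (1 - s) + 1 / (1 - s)) / s"
    using s by (intro divide_right_mono add_mono sum_power_inj_le) (auto simp: inj_on_def)
  also have "\<dots> = 2 / (s * (1 - s))"
    by simp
  finally show ?thesis .
qed

text \<open>With \<open>Q ^ N \<ge> L / s\<close>, the growth of \<open>L powr t\<close> relative to
  \<open>s powr t\<close> is at most \<open>(Q powr t) ^ N\<close>, and
  \<open>exp (- u) \<le> (N / u) ^ N\<close> cancels this power up to a constant.\<close>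

lemma powr_times_double_exp_le:
  fixes L Q c s :: real
  assumes "0 < L" "1 < Q" "0 < c" "0 < s"
  shows "\<exists>K\<ge>1. \<forall>t\<ge>0. L powr t * exp (- (c * Q powr t)) \<le> K * s powr t"
proof -
  obtain N0 where "L / s < Q ^ N0"
    using real_arch_pow[OF assms(2)] by blast
  \<comment> \<open>Passing to a successor makes \<open>N\<close> positive, since it is a divisor
    below.\<close>
  also have "Q ^ N0 \<le> Q ^ Suc N0"
    using assms by (intro power_increasing) auto
  finally obtain N where N: "L / s \<le> Q ^ N" "0 < N"
    by (metis less_imp_le zero_less_Suc)
  have "L powr t * exp (- (c * Q powr t)) \<le> max 1 ((real N / c) ^ N) * s powr t" if "0 \<le> t" for t
  proof -
    define u where "u = c * Q powr t"
    have u: "0 < u" using assms by (simp add: u_def)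
    have "(u / real N) ^ N \<le> exp (real N * (u / real N - 1))"
      using u by (intro power_le_exp_minus_one) auto
    also have "\<dots> \<le> exp u"
      using N by (simp add: algebra_simps)
    finally have e: "exp (- u) \<le> (real N / u) ^ N"
      using u N by (simp add: exp_minus power_divide field_simps)
    have "L powr t \<le> (s * Q ^ N) powr t"
      using N that assms by (intro powr_mono2) (auto simp: field_simps)
    also have "\<dots> = s powr t * (Q powr t) ^ N"
      using assms by (simp add: powr_mult powr_realpow[symmetric] powr_powr mult.commute)
    finally have "L powr t * exp (- u) \<le> s powr t * (Q powr t) ^ N * (real N / u) ^ N"
      using e assms by (intro mult_mono) auto
    also have "\<dots> = (real N / c) ^ N * s powr t"
      using assms by (simp add: u_def power_divide power_mult_distrib)
    also have "\<dots> \<le> max 1 ((real N / c) ^ N) * s powr t"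
      by (intro mult_right_mono) auto
    finally show ?thesis
      by (simp add: u_def)
  qed
  then show ?thesis
    by (intro exI[of _ "max 1 ((real N / c) ^ N)"]) auto
qed

section \<open>Matching bounds for \<open>x = 1 - \<alpha>\<close> between
  \<open>\<epsilon>'\<close> and \<open>p - \<epsilon>\<close>\<close>

context
  fixes p \<epsilon> \<epsilon>' :: real
  assumes p: "0 < p" "p < 1" and eps: "0 < \<epsilon>" "0 < \<epsilon>'"
begin

text \<open>Numerator minus denominator is \<open>p - x \<ge> \<epsilon>\<close>. The lower bound
  gives uniform geometric decay below \<open>n * x\<close>; the upper bound limits the growth above
  it.\<close>

lemma tilting_ratio_bounds:
  assumes x: "\<epsilon>' \<le> x" "x \<le> p - \<epsilon>"
  shows "1 + \<epsilon> \<le> p * (1 - x) / (x * (1 - p))"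
    and "p * (1 - x) / (x * (1 - p)) \<le> 1 / (\<epsilon>' * (1 - p))"
proof -
  have "\<epsilon> * (x * (1 - p)) \<le> \<epsilon> * 1"
    using p eps x by (intro mult_left_mono mult_le_one) auto
  then have "(1 + \<epsilon>) * (x * (1 - p)) \<le> p * (1 - x)"
    using x by (simp add: algebra_simps)
  then show "1 + \<epsilon> \<le> p * (1 - x) / (x * (1 - p))"
    using p eps x by (subst pos_le_divide_eq) auto
  show "p * (1 - x) / (x * (1 - p)) \<le> 1 / (\<epsilon>' * (1 - p))"
    using p eps x by (intro frac_le mult_le_one mult_right_mono mult_pos_pos) auto
qed

text \<open>The expected number of samples inside a fixed set of size \<open>k\<close> thus crosses
  1 at \<open>k = n * x\<close>.\<close>

lemma edge_count_times_power:
  assumes "real m = (1 - p) powr (- ((1 - x) * real n))" "k \<le> n"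
  shows "real m * (1 - p) ^ (n - k) = (1 - p) powr (real n * x - real k)"
  using p assms by (simp add: powr_realpow[symmetric] powr_add[symmetric] of_nat_diff algebra_simps)

text \<open>The single layer at the floor of \<open>n * x\<close> suffices: its tilted weight has
  order \<open>1 / sqrt n\<close>.\<close>

lemma expected_min_mid_lower:
  "\<exists>c>0. \<exists>N. \<forall>n\<ge>N. \<forall>m>0. \<forall>x. \<epsilon>' \<le> x \<longrightarrow> x \<le> p - \<epsilon> \<longrightarrow>
    real m = (1 - p) powr (- ((1 - x) * real n)) \<longrightarrow>
    c * (entropy_factor p x ^ n / sqrt (real n)) \<le> expected_min n m p"
proof -
  define \<delta> where "\<delta> = min \<epsilon>' (1 - p)"
  have \<delta>: "0 < \<delta>" "\<delta> \<le> \<epsilon>'" "\<delta> \<le> 1 - p"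
    using p eps by (auto simp: \<delta>_def)
  define d where "d = exp (- 2 - 1 / \<delta>\<^sup>2)"
  have d: "0 < d" by (simp add: d_def)
  define L where "L = \<epsilon>' * (1 - p)"
  have L: "0 < L" using p eps by (simp add: L_def)
  obtain N where N: "\<And>n. n \<ge> N \<Longrightarrow> 1 / \<delta> + 1 < sqrt (real n)"
    using sqrt_eventually_gt by blast
  have "exp (- 1) * d * L * (entropy_factor p x ^ n / sqrt (real n)) \<le> expected_min n m p"
    if "n \<ge> N" "0 < m" and x: "\<epsilon>' \<le> x" "x \<le> p - \<epsilon>"
      and m: "real m = (1 - p) powr (- ((1 - x) * real n))" for n m x
  proof -
    let ?s = "sqrt (real n)"
    let ?l = "p * (1 - x) / (x * (1 - p))"
    have x01: "0 < x" "x < 1" using x p eps by auto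
    have s: "1 / \<delta> < ?s" "1 < ?s"
      using N[OF \<open>n \<ge> N\<close>] divide_pos_pos[OF zero_less_one \<delta>(1)] by linarith+
    have ds: "1 < \<delta> * ?s"
      using s \<delta> by (simp add: field_simps)
    define k where "k = nat \<lfloor>real n * x\<rfloor>"
    have k: "real k \<le> real n * x" "real n * x < real k + 1"
      using x01 by (simp_all add: k_def)
    have "real n * x \<le> real n * 1"
      using x01 by (intro mult_left_mono) auto
    then have kn: "k \<le> n" using k by simp
    have "\<bar>real k - real n * x\<bar> \<le> ?s"
      using k s by linarith
    then have sq: "(real k - real n * x)\<^sup>2 \<le> real n"
      by (rule sqrt_ge_absD)
    have B: "d / ?s \<le> Bernstein n k x"
      unfolding d_def using \<delta> ds sq x eps by (intro Bernstein_local_lower) auto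
    \<comment> \<open>Rounding down makes the tilting exponent at least -1, so the loss is at most
      the reciprocal of the largest odds ratio.\<close>
    have "L = (1 / L) powr (- 1)"
      using L by (simp add: powr_minus_divide)
    also have "\<dots> \<le> ?l powr (- 1)"
      using tilting_ratio_bounds[OF x] eps by (intro powr_mono2') (auto simp: L_def)
    also have "\<dots> \<le> ?l powr (real k - real n * x)"
      using tilting_ratio_bounds(1)[OF x] eps k by (intro powr_mono) auto
    finally have l: "L \<le> ?l powr (real k - real n * x)" .
    have G: "0 \<le> entropy_factor p x ^ n"
      by (simp add: entropy_factor_def)
    have "exp (- 1) * d * L * (entropy_factor p x ^ n / ?s)
        = exp (- 1) * (entropy_factor p x ^ n * (d / ?s) * L)"
      by simp
    also have "\<dots> \<le> exp (- 1) * (entropy_factor p x ^ n * Bernstein n k x * ?l powr (real k - real n * x))"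
      using B l G d L s x01 by (intro mult_mono) (auto intro!: mult_nonneg_nonneg Bernstein_nonneg)
    also have "\<dots> = exp (- 1) * (\<Sum>k\<in>{k}. real m * Bernstein n k p)"
      using Bernstein_exponential_tilting[OF p x01 kn] m by simp
    also have "\<dots> \<le> expected_min n m p"
    proof (intro expected_min_lower p \<open>0 < m\<close>)
      have "real m * (1 - p) ^ (n - k) \<le> (1 - p) powr 0"
        unfolding edge_count_times_power[OF m kn] using p k by (intro powr_mono') auto
      then show "(1 - p) ^ (n - j) \<le> 1 / real m" if "j \<in> {k}" for j
        using that p \<open>0 < m\<close> by (simp add: field_simps)
    qed (use kn in auto)
    finally show ?thesis .
  qed
  then show ?thesis
    using d L by (intro exI[of _ "exp (- 1) * d * L"]) auto
qed

text \<open>With the cutoff at \<open>n * x\<close>, each term is at most the entropy factor times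
  \<open>D / sqrt n\<close> times a constant multiple of
  \<open>s powr \<bar>k - n * x\<bar>\<close>, and the last factor has a bounded sum.\<close>

lemma expected_min_mid_upper:
  "\<exists>C>0. \<forall>n>0. \<forall>m\<ge>2. \<forall>x. \<epsilon>' \<le> x \<longrightarrow> x \<le> p - \<epsilon> \<longrightarrow>
    real m = (1 - p) powr (- ((1 - x) * real n)) \<longrightarrow>
    expected_min n m p \<le> C * (entropy_factor p x ^ n / sqrt (real n))"
proof -
  define \<delta> where "\<delta> = min \<epsilon>' (1 - p)"
  have \<delta>: "0 < \<delta>" "\<delta> \<le> \<epsilon>'" "\<delta> \<le> 1 - p"
    using p eps by (auto simp: \<delta>_def)
  define D where "D = 2 * exp 1 / \<delta> + 4 / \<delta>\<^sup>2"
  have D: "0 < D" using \<delta> by (simp add: D_def add_pos_pos)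
  define L where "L = 1 / (\<epsilon>' * (1 - p))"
  have L: "0 < L" using p eps by (simp add: L_def)
  \<comment> \<open>Below the cutoff the tilting factor itself decays at this rate; above it,
    \<open>K\<close> is chosen so that the double exponential beats the growing tilting factor at
    the same rate.\<close>
  define s where "s = 1 / (1 + \<epsilon>)"
  have s: "0 < s" "s < 1" using eps by (auto simp: s_def)
  have "\<exists>K\<ge>1. \<forall>t\<ge>0. L powr t * exp (- ((1 - p) / 2 * (1 / (1 - p)) powr t)) \<le> K * s powr t"
    using p L s by (intro powr_times_double_exp_le) auto
  then obtain K where K: "1 \<le> K"
    "\<And>t. t \<ge> 0 \<Longrightarrow> L powr t * exp (- ((1 - p) / 2 * (1 / (1 - p)) powr t)) \<le> K * s powr t"
    by auto
  define S where "S = 2 / (s * (1 - s))"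
  have S: "0 < S" using s by (simp add: S_def)
  have "expected_min n m p \<le> D * K * S * (entropy_factor p x ^ n / sqrt (real n))"
    if "0 < n" "2 \<le> m" and x: "\<epsilon>' \<le> x" "x \<le> p - \<epsilon>"
      and m: "real m = (1 - p) powr (- ((1 - x) * real n))" for n m x
  proof -
    let ?l = "p * (1 - x) / (x * (1 - p))"
    let ?G = "entropy_factor p x ^ n"
    have x01: "0 < x" "x < 1" using x p eps by auto
    have G: "0 \<le> ?G"
      by (simp add: entropy_factor_def)
    have l: "1 + \<epsilon> \<le> ?l" "?l \<le> L"
      using tilting_ratio_bounds[OF x] by (auto simp: L_def)
    have "expected_min n m p \<le> (\<Sum>k\<le>n. real m * Bernstein n k p *
      (if real k \<le> real n * x then 1 else exp (- ((1 - p) / 2 * (real m * (1 - p) ^ (n - k))))))"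
      using x01 by (intro expected_min_upper p that) auto
    also have "\<dots> \<le> (\<Sum>k\<le>n. ?G * (D / sqrt (real n)) * (K * s powr \<bar>real k - real n * x\<bar>))"
    proof (rule sum_mono)
      fix k assume "k \<in> {..n}"
      then have kn: "k \<le> n" by simp
      define t where "t = real k - real n * x"
      define g where "g = (if real k \<le> real n * x then 1 else exp (- ((1 - p) / 2 * (real m * (1 - p) ^ (n - k)))))"
      have gn: "0 \<le> g"
        by (simp add: g_def)
      have B: "Bernstein n k x \<le> D / sqrt (real n)"
        unfolding D_def using \<delta> x eps that kn by (intro Bernstein_le_inverse_sqrt) auto
      have lg: "?l powr t * g \<le> K * s powr \<bar>t\<bar>"
      proof (cases "t \<le> 0")
        case True
        have "?l powr t \<le> (1 + \<epsilon>) powr t"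
          using True l eps by (intro powr_mono2') auto
        also have "\<dots> = s powr \<bar>t\<bar>"
          using True eps by (simp add: s_def powr_divide powr_minus_divide)
        also have "\<dots> \<le> K * s powr \<bar>t\<bar>"
          using K(1) by (simp add: mult_le_cancel_right1)
        finally show ?thesis
          using True by (simp add: g_def t_def)
      next
        case False
        have "real m * (1 - p) ^ (n - k) = (1 / (1 - p)) powr t"
          using edge_count_times_power[OF m kn] p
          by (simp add: t_def powr_divide powr_minus_divide[symmetric])
        then have g: "g = exp (- ((1 - p) / 2 * (1 / (1 - p)) powr t))"
          using False by (simp add: g_def t_def)
        have "?l powr t * g \<le> L powr t * g"
          using False l eps by (intro mult_right_mono powr_mono2) (auto simp: g)
        also have "\<dots> \<le> K * s powr \<bar>t\<bar>"
          using K(2)[of t] False unfolding g by simp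
        finally show ?thesis .
      qed
      have "real m * Bernstein n k p * g = ?G * Bernstein n k x * (?l powr t * g)"
        using Bernstein_exponential_tilting[OF p x01 kn] m by (simp add: t_def)
      also have "\<dots> \<le> ?G * (D / sqrt (real n)) * (K * s powr \<bar>t\<bar>)"
        using G D x01 gn by (intro mult_mono B lg order_refl) (auto intro!: mult_nonneg_nonneg Bernstein_nonneg)
      finally show "real m * Bernstein n k p *
        (if real k \<le> real n * x then 1 else exp (- ((1 - p) / 2 * (real m * (1 - p) ^ (n - k)))))
        \<le> ?G * (D / sqrt (real n)) * (K * s powr \<bar>real k - real n * x\<bar>)"
        by (simp add: g_def t_def)
    qed
    also have "\<dots> = ?G * (D / sqrt (real n)) * K * (\<Sum>k\<le>n. s powr \<bar>real k - real n * x\<bar>)"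
      by (simp add: sum_distrib_left mult.assoc)
    also have "\<dots> \<le> ?G * (D / sqrt (real n)) * K * S"
      unfolding S_def using s G D K(1) x01 by (intro mult_left_mono sum_powr_abs_le) auto
    finally show ?thesis by (simp add: mult_ac)
  qed
  then show ?thesis
    using D K(1) S by (intro exI[of _ "D * K * S"]) auto
qed

text \<open>Powers of \<open>1 - p\<close> decrease in the exponent, so the bounds on
  \<open>m\<close> become bounds on \<open>x\<close>. Since \<open>x < 1\<close>, \<open>m\<close>
  exceeds 1, as the upper estimate requires.\<close>

lemma edge_count_exponent:
  fixes n m :: nat
  assumes "0 < n" "0 < m"
    and lo: "1 / (1 - p) powr ((1 - p + \<epsilon>) * real n) \<le> real m"
    and hi: "real m \<le> 1 / (1 - p) powr ((1 - \<epsilon>') * real n)"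
  defines "x \<equiv> 1 + log (1 - p) (real m) / real n"
  shows "\<epsilon>' \<le> x" "x \<le> p - \<epsilon>" "real m = (1 - p) powr (- ((1 - x) * real n))" "2 \<le> m"
proof -
  have q: "0 < 1 - p" "1 - p < 1" using p by auto
  have "- ((1 - x) * real n) = log (1 - p) (real m)"
    using assms(1) by (simp add: x_def)
  then show m: "real m = (1 - p) powr (- ((1 - x) * real n))"
    using q assms(2) by simp
  have mono: "a \<le> b" if "(1 - p) powr b \<le> (1 - p) powr a" for a b
    using powr_less_mono'[OF q, of b a] that by (meson not_le)
  have "- ((1 - x) * real n) \<le> - ((1 - p + \<epsilon>) * real n)"
    by (rule mono, fold m, unfold powr_minus_divide, rule lo)
  then have "(1 - p + \<epsilon>) * real n \<le> (1 - x) * real n" by simp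
  then show xp: "x \<le> p - \<epsilon>"
    using assms(1) by (simp add: mult_le_cancel_right)
  have "- ((1 - \<epsilon>') * real n) \<le> - ((1 - x) * real n)"
    by (rule mono, fold m, unfold powr_minus_divide, rule hi)
  then have "(1 - x) * real n \<le> (1 - \<epsilon>') * real n" by simp
  then show "\<epsilon>' \<le> x"
    using assms(1) by (simp add: mult_le_cancel_right)
  have "0 < (1 - x) * real n"
    using xp p eps assms(1) by simp
  then have "(1 - p) powr 0 < real m"
    unfolding m using q by (intro powr_less_mono') auto
  then show "2 \<le> m" using q by simp
qed

text \<open>\<open>A\<close> and \<open>B\<close> both equal the entropy factor power over
  \<open>sqrt n\<close>, so one pair of estimates gives all four inequalities.\<close>

lemma expected_min_mid_m:
  "\<exists>c>0. \<exists>C>0. \<exists>N. \<forall>n\<ge>N. \<forall>m::nat. m > 0 \<longrightarrow>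
            1 / (1 - p) powr ((1 - p + \<epsilon>) * real n) \<le> real m \<longrightarrow>
            real m \<le> 1 / (1 - p) powr ((1 - \<epsilon>') * real n) \<longrightarrow>
            (let \<alpha> = - (log (1 - p) (real m) / real n);
                 A = 2 powr ((binary_entropy \<alpha> + (1 - \<alpha>) * log 2 p) * real n) / sqrt (real n);
                 B = (p powr (1 - \<alpha>) / ((1 - \<alpha>) powr (1 - \<alpha>) * \<alpha> powr \<alpha>)) ^ n / sqrt (real n)
             in c * A \<le> expected_min n m p \<and> expected_min n m p \<le> C * A \<and>
                c * B \<le> expected_min n m p \<and> expected_min n m p \<le> C * B)"
proof -
  obtain c N where c: "0 < c" and lower: "\<And>n m x. n \<ge> N \<Longrightarrow> m > 0 \<Longrightarrow> \<epsilon>' \<le> x \<Longrightarrow> x \<le> p - \<epsilon> \<Longrightarrow>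
    real m = (1 - p) powr (- ((1 - x) * real n)) \<Longrightarrow>
    c * (entropy_factor p x ^ n / sqrt (real n)) \<le> expected_min n m p"
    using expected_min_mid_lower by blast
  obtain C where C: "0 < C" and upper: "\<And>n m x. n > 0 \<Longrightarrow> m \<ge> 2 \<Longrightarrow> \<epsilon>' \<le> x \<Longrightarrow> x \<le> p - \<epsilon> \<Longrightarrow>
    real m = (1 - p) powr (- ((1 - x) * real n)) \<Longrightarrow>
    expected_min n m p \<le> C * (entropy_factor p x ^ n / sqrt (real n))"
    using expected_min_mid_upper by blast
  show ?thesis
  proof (rule exI[of _ c], rule conjI[OF c], rule exI[of _ C], rule conjI[OF C],
      rule exI[of _ "max 1 N"], intro allI impI)
    fix n m :: nat
    assume n: "max 1 N \<le> n" and m0: "0 < m"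
      and lo: "1 / (1 - p) powr ((1 - p + \<epsilon>) * real n) \<le> real m"
      and hi: "real m \<le> 1 / (1 - p) powr ((1 - \<epsilon>') * real n)"
    have n0: "0 < n" "N \<le> n" using n by auto
    define x where "x = 1 + log (1 - p) (real m) / real n"
    note x = edge_count_exponent[OF n0(1) m0 lo hi, folded x_def]
    have \<alpha>: "- (log (1 - p) (real m) / real n) = 1 - x"
      by (simp add: x_def)
    have x01: "0 < x" "x < 1" using x p eps by auto
    have E: "c * (entropy_factor p x ^ n / sqrt (real n)) \<le> expected_min n m p"
      "expected_min n m p \<le> C * (entropy_factor p x ^ n / sqrt (real n))"
      using lower[OF n0(2) m0 x(1-3)] upper[OF n0(1) x(4) x(1-3)] by auto
    have A: "2 powr ((binary_entropy (1 - x) + (1 - (1 - x)) * log 2 p) * real n) = entropy_factor p x ^ n"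
      using two_powr_entropy[OF p(1) x01] by simp
    have B: "p powr (1 - (1 - x)) / ((1 - (1 - x)) powr (1 - (1 - x)) * (1 - x) powr (1 - x)) = entropy_factor p x"
      by (simp add: entropy_factor_def)
    show "let \<alpha> = - (log (1 - p) (real m) / real n);
                 A = 2 powr ((binary_entropy \<alpha> + (1 - \<alpha>) * log 2 p) * real n) / sqrt (real n);
                 B = (p powr (1 - \<alpha>) / ((1 - \<alpha>) powr (1 - \<alpha>) * \<alpha> powr \<alpha>)) ^ n / sqrt (real n)
             in c * A \<le> expected_min n m p \<and> expected_min n m p \<le> C * A \<and>
                c * B \<le> expected_min n m p \<and> expected_min n m p \<le> C * B"
      unfolding Let_def \<alpha> A B using E by blast
  qed
qed

end

subsection \<open>Many edges\<close>

lemma expected_min_large_m: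
  fixes m :: "nat \<Rightarrow> nat" and f :: "nat \<Rightarrow> real"
  assumes p: "0 < p" "p < 1" and m0: "\<forall>n>0. m n > 0"
    and m: "\<forall>n>0. real (m n) = 1 / (1 - p) powr (real n + f n)"
    and f: "f \<in> \<omega>(\<lambda>n. ln (real n))" "\<forall>\<^sub>F n in sequentially. f n \<ge> 0"
  shows "(\<lambda>n. expected_min n (m n) p - 1) \<in> o(\<lambda>_. 1)"
proof -
  have q: "0 < 1 - p" "1 - p < 1" "ln (1 - p) < 0" using p by auto
  \<comment> \<open>Chosen so that \<open>f n \<ge> M * ln n\<close> means
    \<open>(1 - p) powr (- f n) \<ge> n\<^sup>2\<close>, that is
    \<open>m n * (1 - p) ^ n \<ge> n\<^sup>2\<close>. The resulting Gaussian-type decay defeats the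
    \<open>2 ^ n\<close> of the union bound.\<close>
  define M where "M = 2 / (- ln (1 - p))"
  have M: "0 < M" using q by (simp add: M_def)
  have "\<forall>\<^sub>F n in sequentially. M * norm (ln (real n)) \<le> norm (f n)"
    using landau_omega.smallD[OF f(1) M] .
  then have ub: "\<forall>\<^sub>F n in sequentially.
    expected_min n (m n) p - 1 \<le> 2 ^ n * exp (- ((1 - p) * real n ^ 2))"
    using f(2) eventually_gt_at_top[of 0]
  proof eventually_elim
    case (elim n)
    have "M * ln (real n) \<le> f n" using elim by simp
    then have "2 * ln (real n) \<le> f n * (- ln (1 - p))"
      using q by (simp add: M_def field_simps)
    then have "exp (2 * ln (real n)) \<le> exp (- f n * ln (1 - p))"
      by simp
    then have "real n ^ 2 \<le> (1 - p) powr (- f n)"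
      using elim q by (simp add: exp_double powr_def)
    also have "\<dots> = real (m n) * (1 - p) ^ n"
      using m elim q by (simp add: powr_add powr_realpow powr_minus_divide)
    finally have "(1 - p) * real n ^ 2 \<le> (1 - p) * (real (m n) * (1 - p) ^ n)"
      using q by (intro mult_left_mono) auto
    then have "exp (- (real (m n) * ((1 - p) * (1 - p) ^ n))) \<le> exp (- ((1 - p) * real n ^ 2))"
      by (simp add: mult_ac)
    then have "2 ^ n * exp (- (real (m n) * ((1 - p) * (1 - p) ^ n))) \<le> 2 ^ n * exp (- ((1 - p) * real n ^ 2))"
      by (intro mult_left_mono) auto
    then show ?case
      using expected_min_le_1_plus[OF p, of n "m n"] by linarith
  qed
  have lb: "\<forall>\<^sub>F n in sequentially. 0 \<le> expected_min n (m n) p - 1"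
    using eventually_gt_at_top[of 0] by eventually_elim (use m0 expected_min_ge_1 in auto)
  have "(\<lambda>n. 2 ^ n * exp (- ((1 - p) * real n ^ 2))) \<longlonglongrightarrow> 0"
    using q(1) by real_asymp
  then have "(\<lambda>n. expected_min n (m n) p - 1) \<longlonglongrightarrow> 0"
    by (rule tendsto_sandwich[OF lb ub tendsto_const])
  then show ?thesis
    by (intro smalloI_tendsto) auto
qed

theorem theorem1:
  fixes p :: real
  assumes "0 \<le> p" and "p \<le> 1"
  shows
    "(p = 0 \<or> p = 1 \<longrightarrow>
        (\<forall>n>0. \<forall>m>0. \<forall>H \<in> set_pmf (random_hypergraph n m p). card (minimization H) = 1))
     \<and>
     (0 < p \<and> p < 1 \<longrightarrow>
        (\<exists>c>0. \<exists>C>0. \<exists>N. \<forall>n\<ge>N. \<forall>m::nat. m > 0 \<longrightarrow>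
            real m \<le> 1 / (1 - p) powr ((1 - p) * real n) \<longrightarrow>
            c * real m \<le> expected_min n m p \<and> expected_min n m p \<le> C * real m)
        \<and>
        (\<forall>\<epsilon>>0. \<forall>\<epsilon>'>0. \<exists>c>0. \<exists>C>0. \<exists>N. \<forall>n\<ge>N. \<forall>m::nat. m > 0 \<longrightarrow>
            1 / (1 - p) powr ((1 - p + \<epsilon>) * real n) \<le> real m \<longrightarrow>
            real m \<le> 1 / (1 - p) powr ((1 - \<epsilon>') * real n) \<longrightarrow>
            (let \<alpha> = - (log (1 - p) (real m) / real n);
                 A = 2 powr ((binary_entropy \<alpha> + (1 - \<alpha>) * log 2 p) * real n) / sqrt (real n);
                 B = (p powr (1 - \<alpha>) / ((1 - \<alpha>) powr (1 - \<alpha>) * \<alpha> powr \<alpha>)) ^ n / sqrt (real n)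
             in c * A \<le> expected_min n m p \<and> expected_min n m p \<le> C * A \<and>
                c * B \<le> expected_min n m p \<and> expected_min n m p \<le> C * B))
        \<and>
        (\<forall>(m :: nat \<Rightarrow> nat) (f :: nat \<Rightarrow> real).
            (\<forall>n>0. m n > 0) \<longrightarrow>
            (\<forall>n>0. real (m n) = 1 / (1 - p) powr (real n + f n)) \<longrightarrow>
            f \<in> \<omega>(\<lambda>n. ln (real n)) \<longrightarrow>
            (\<forall>\<^sub>F n in sequentially. f n \<ge> 0) \<longrightarrow>
            (\<forall>n>0. 1 \<le> expected_min n (m n) p) \<and>
            (\<lambda>n. expected_min n (m n) p - 1) \<in> o(\<lambda>_. 1)))"
proof (intro conjI impI)
  assume "p = 0 \<or> p = 1"
  then show "\<forall>n>0. \<forall>m>0. \<forall>H \<in> set_pmf (random_hypergraph n m p). card (minimization H) = 1"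
    using card_minimization_degenerate by blast
next
  assume p: "0 < p \<and> p < 1"
  then obtain c N where c: "c > 0" "\<And>n m. n \<ge> N \<Longrightarrow> m > 0 \<Longrightarrow>
      real m \<le> 1 / (1 - p) powr ((1 - p) * real n) \<Longrightarrow> c * real m \<le> expected_min n m p"
    using expected_min_small_m[of p] by blast
  then have "\<forall>n\<ge>N. \<forall>m::nat. m > 0 \<longrightarrow>
            real m \<le> 1 / (1 - p) powr ((1 - p) * real n) \<longrightarrow>
            c * real m \<le> expected_min n m p \<and> expected_min n m p \<le> 1 * real m"
    using p expected_min_le[of p] by simp
  then show "\<exists>c>0. \<exists>C>0. \<exists>N. \<forall>n\<ge>N. \<forall>m::nat. m > 0 \<longrightarrow>
            real m \<le> 1 / (1 - p) powr ((1 - p) * real n) \<longrightarrow>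
            c * real m \<le> expected_min n m p \<and> expected_min n m p \<le> C * real m"
    using c(1) zero_less_one by blast
next
  assume p: "0 < p \<and> p < 1"
  show "\<forall>\<epsilon>>0. \<forall>\<epsilon>'>0. \<exists>c>0. \<exists>C>0. \<exists>N. \<forall>n\<ge>N. \<forall>m::nat. m > 0 \<longrightarrow>
            1 / (1 - p) powr ((1 - p + \<epsilon>) * real n) \<le> real m \<longrightarrow>
            real m \<le> 1 / (1 - p) powr ((1 - \<epsilon>') * real n) \<longrightarrow>
            (let \<alpha> = - (log (1 - p) (real m) / real n);
                 A = 2 powr ((binary_entropy \<alpha> + (1 - \<alpha>) * log 2 p) * real n) / sqrt (real n);
                 B = (p powr (1 - \<alpha>) / ((1 - \<alpha>) powr (1 - \<alpha>) * \<alpha> powr \<alpha>)) ^ n / sqrt (real n)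
             in c * A \<le> expected_min n m p \<and> expected_min n m p \<le> C * A \<and>
                c * B \<le> expected_min n m p \<and> expected_min n m p \<le> C * B)"
    by (intro allI impI expected_min_mid_m) (use p in auto)
next
  assume p: "0 < p \<and> p < 1"
  then show "\<forall>(m :: nat \<Rightarrow> nat) (f :: nat \<Rightarrow> real).
            (\<forall>n>0. m n > 0) \<longrightarrow>
            (\<forall>n>0. real (m n) = 1 / (1 - p) powr (real n + f n)) \<longrightarrow>
            f \<in> \<omega>(\<lambda>n. ln (real n)) \<longrightarrow>
            (\<forall>\<^sub>F n in sequentially. f n \<ge> 0) \<longrightarrow>
            (\<forall>n>0. 1 \<le> expected_min n (m n) p) \<and>
            (\<lambda>n. expected_min n (m n) p - 1) \<in> o(\<lambda>_. 1)"
    by (intro allI impI conjI expected_min_ge_1 expected_min_large_m) auto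
qed

end
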